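(* Let $\Omega$ be a Lipschitz cone in $\mathbb{R}^n$, $n\ge2$. Let $\mu\le\mu_0$, and let $$\lambda(\mu):=\frac{(2-n)^2+4\sigma(\mu)}{4}.$$ Then $\lambda(\mu)\ge0$, and the following Hardy inequality holds true in $\Omega$: $$\int_\Omega|\nabla\varphi|^2\,dx-\mu\int_\Omega\frac{|\varphi|^2}{\delta_\Omega^2}\,dx\ \ge\ \lambda(\mu)\int_\Omega\frac{|\varphi|^2}{|x|^2}\,dx\qquad\forall\varphi\in C_0^\infty(\Omega).$$
   Context: A Lipschitz cone is a set $\Omega=\{x\in\mathbb{R}^n : |x|>0,\ x/|x|\in\Sigma\}$, where $\Sigma$ is a Lipschitz domain (open, connected) in the unit sphere $\mathbb{S}^{n-1}$, $n\ge2$. $\delta_\Omega(x)=\mathrm{dist}(x,\partial\Omega)$. For a symmetric second-order elliptic operator $P$ on a domain $D$ (of $\mathbb{R}^n$ or of $\mathbb{S}^{n-1}$), $P\ge0$ in $D$ means that $Pu=0$ admits a positive (super)solution in $D$; equivalently, the quadratic form of $P$ is nonnegative on $C_0^\infty(D)$. For $W\ge 0$, $W\ne0$, $\lambda_0(P,W,D):=\sup\{\lambda\in\mathbb{R}: P-\lambda W\ge0\text{ in }D\}$. $\mu_0:=\lambda_0(-\Delta,\delta_\Omega^{-2},\Omega)$. $\Delta_S$ is the Laplace–Beltrami operator on $\mathbb{S}^{n-1}$, and $\sigma(\mu):=\lambda_0(-\Delta_S-\mu\,\delta_\Omega^{-2},\mathbf{1},\Sigma)$, where $\delta_\Omega$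 is restricted to $\Sigma\subset\Omega$. *)

theory Defs
  imports "HOL-Analysis.Analysis"
begin

section \<open>Cones over Lipschitz domains of the sphere\<close>

text \<open>
  The ambient Euclidean space is \<open>'a::euclidean_space\<close>, of dimension \<open>n = DIM('a)\<close>; the unit sphere
  is \<open>sphere 0 1\<close>; \<open>sgn x\<close> is \<open>x / |x|\<close> for \<open>x \<noteq> 0\<close>.

  Near a point \<open>p\<close> of the sphere, \<open>y \<mapsto> y - (y \<bullet> p) p\<close> is a smooth chart with values in the
  hyperplane orthogonal to \<open>p\<close>. In this chart a Lipschitz domain lies, near each of its boundary
  points, strictly above the graph of a Lipschitz function, \<open>e\<close> being the vertical direction.
  (If \<open>n = 2\<close>, the graph function is a constant.) The whole sphere has no boundary points
  and is a Lipschitz domain.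
\<close>

definition lipschitz_domain_sphere :: "'a::euclidean_space set \<Rightarrow> bool" where
  "lipschitz_domain_sphere S \<longleftrightarrow>
     S \<noteq> {} \<and> openin (top_of_set (sphere 0 1)) S \<and> connected S \<and>
     (\<forall>p \<in> (top_of_set (sphere 0 1)) frontier_of S.
        \<exists>e r L g. norm e = 1 \<and> e \<bullet> p = 0 \<and> 0 < r \<and>
          L-lipschitz_on {z. z \<bullet> p = 0 \<and> z \<bullet> e = 0} g \<and>
          (\<forall>y \<in> sphere 0 1 \<inter> ball p r.
             y \<in> S \<longleftrightarrow> g (y - (y \<bullet> p) *\<^sub>R p - (y \<bullet> e) *\<^sub>R e) < y \<bullet> e))"

definition cone_over :: "'a::euclidean_space set \<Rightarrow> 'a set" where
  "cone_over S = {x. norm x > 0 \<and> sgn x \<in> S}"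

definition bdist :: "'a::euclidean_space set \<Rightarrow> 'a \<Rightarrow> real" where
  "bdist D x = infdist x (frontier D)"

section \<open>Test functions and differential operators\<close>

definition partial_deriv :: "'a::euclidean_space \<Rightarrow> ('a \<Rightarrow> real) \<Rightarrow> 'a \<Rightarrow> real" where
  "partial_deriv b f x = frechet_derivative f (at x) b"

definition grad :: "('a::euclidean_space \<Rightarrow> real) \<Rightarrow> 'a \<Rightarrow> 'a" where
  "grad f x = (\<Sum>b\<in>Basis. partial_deriv b f x *\<^sub>R b)"

definition laplacian :: "('a::euclidean_space \<Rightarrow> real) \<Rightarrow> 'a \<Rightarrow> real" where
  "laplacian f x = (\<Sum>b\<in>Basis. partial_deriv b (partial_deriv b f) x)"

text \<open>To be used for open sets \<open>U\<close> only.\<close>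

primrec Ck_on :: "nat \<Rightarrow> 'a::euclidean_space set \<Rightarrow> ('a \<Rightarrow> real) \<Rightarrow> bool" where
  "Ck_on 0 U f \<longleftrightarrow> continuous_on U f"
| "Ck_on (Suc k) U f \<longleftrightarrow>
     (\<forall>x\<in>U. f differentiable (at x)) \<and> (\<forall>b\<in>Basis. Ck_on k U (partial_deriv b f))"

definition smooth_on :: "'a::euclidean_space set \<Rightarrow> ('a \<Rightarrow> real) \<Rightarrow> bool" where
  "smooth_on U f \<longleftrightarrow> (\<forall>k. Ck_on k U f)"

text \<open>Test functions on \<open>D\<close> are extended by zero to the whole space.\<close>

definition test_fun :: "'a::euclidean_space set \<Rightarrow> ('a \<Rightarrow> real) set" where
  "test_fun D = {\<phi>. smooth_on UNIV \<phi> \<and>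
     compact (closure {x. \<phi> x \<noteq> 0}) \<and> closure {x. \<phi> x \<noteq> 0} \<subseteq> D}"

text \<open>
  A function on the sphere is extended to the complement of the origin as a function homogeneous
  of degree \<open>0\<close>. It is smooth on the sphere iff the extension is smooth, and its Laplace-Beltrami
  operator is the restriction to the sphere of the Laplacian of the extension: in polar
  coordinates \<open>\<Delta> = \<partial>\<^sub>r\<^sup>2 + (n - 1)/r \<partial>\<^sub>r + \<Delta>\<^sub>S/r\<^sup>2\<close>. Values off the sphere are ignored.
\<close>

definition sphere_ext :: "('a::euclidean_space \<Rightarrow> real) \<Rightarrow> 'a \<Rightarrow> real" where
  "sphere_ext \<psi> x = \<psi> (sgn x)"

definition test_fun_sphere :: "'a::euclidean_space set \<Rightarrow> ('a \<Rightarrow> real) set" where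
  "test_fun_sphere S = {\<psi>. smooth_on (- {0}) (sphere_ext \<psi>) \<and>
     closure {x \<in> sphere 0 1. \<psi> x \<noteq> 0} \<subseteq> S}"

definition laplace_beltrami :: "('a::euclidean_space \<Rightarrow> real) \<Rightarrow> 'a \<Rightarrow> real" where
  "laplace_beltrami \<psi> x = laplacian (sphere_ext \<psi>) x"

text \<open>
  Surface measure of the sphere, as a Borel measure on the whole space concentrated on the sphere:
  the measure of \<open>A\<close> is \<open>n\<close> times the volume of the part of the unit ball lying radially over \<open>A\<close>.
\<close>

definition surface_measure :: "'a::euclidean_space measure" where
  "surface_measure = scale_measure (of_nat DIM('a))
     (distr (restrict_space lborel (ball 0 1 - {0})) borel sgn)"

lemma measurable_sgn_euclidean: "(sgn :: 'a::euclidean_space \<Rightarrow> 'a) \<in> borel_measurable borel"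
  unfolding sgn_div_norm by measurable

lemma emeasure_surface_measure:
  fixes A :: "'a::euclidean_space set"
  assumes "A \<in> sets borel"
  shows "emeasure surface_measure A =
    of_nat DIM('a) * emeasure lborel {x \<in> ball 0 1 - {0}. sgn x \<in> A}"
proof -
  let ?R = "restrict_space lborel (ball 0 1 - {0 :: 'a})"
  have B: "ball 0 1 - {0 :: 'a} \<in> sets lborel"
    by auto
  have m: "sgn \<in> measurable ?R borel"
    using measurable_sgn_euclidean by (intro measurable_restrict_space1) auto
  have eq: "sgn -` A \<inter> space ?R = {x \<in> ball 0 1 - {0}. sgn x \<in> A}"
    by (auto simp: space_restrict_space)
  have "emeasure (distr ?R borel sgn) A = emeasure ?R (sgn -` A \<inter> space ?R)"
    by (rule emeasure_distr[OF m assms])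
  also have "\<dots> = emeasure lborel {x \<in> ball 0 1 - {0}. sgn x \<in> A}"
    unfolding eq using B by (subst emeasure_restrict_space) auto
  finally show ?thesis
    by (simp add: surface_measure_def)
qed

section \<open>Nonnegativity and the generalized principal eigenvalue\<close>

text \<open>
  \<open>P \<ge> 0\<close> in \<open>D\<close> in the sense of the quadratic form \<open>\<phi> \<mapsto> \<integral>\<^sub>D \<phi> P\<phi>\<close> on test functions. Here \<open>M\<close> is
  the volume measure of the ambient manifold and \<open>T\<close> the class of test functions on \<open>D\<close>. The
  supremum is taken in the extended reals, so that no value is assigned by convention to the
  supremum of an empty or unbounded set.
\<close>

definition op_nonneg ::
    "'a measure \<Rightarrow> ('a \<Rightarrow> real) set \<Rightarrow> (('a \<Rightarrow> real) \<Rightarrow> 'a \<Rightarrow> real) \<Rightarrow> 'a set \<Rightarrow> bool" where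
  "op_nonneg M T P D \<longleftrightarrow> (\<forall>\<phi>\<in>T. 0 \<le> (LINT x:D|M. \<phi> x * P \<phi> x))"

definition lambda0 ::
    "(('a::euclidean_space \<Rightarrow> real) \<Rightarrow> 'a \<Rightarrow> real) \<Rightarrow> ('a \<Rightarrow> real) \<Rightarrow> 'a set \<Rightarrow> ereal" where
  "lambda0 P W D = Sup {ereal l | l.
     op_nonneg lborel (test_fun D) (\<lambda>u x. P u x - l * W x * u x) D}"

definition lambda0_sphere ::
    "(('a::euclidean_space \<Rightarrow> real) \<Rightarrow> 'a \<Rightarrow> real) \<Rightarrow> ('a \<Rightarrow> real) \<Rightarrow> 'a set \<Rightarrow> ereal" where
  "lambda0_sphere P W S = Sup {ereal l | l.
     op_nonneg surface_measure (test_fun_sphere S) (\<lambda>u x. P u x - l * W x * u x) S}"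

definition mu0 :: "'a::euclidean_space set \<Rightarrow> ereal" where
  "mu0 D = lambda0 (\<lambda>u x. - laplacian u x) (\<lambda>x. 1 / (bdist D x)\<^sup>2) D"

definition sigma :: "'a::euclidean_space set \<Rightarrow> real \<Rightarrow> ereal" where
  "sigma S \<mu> = lambda0_sphere
     (\<lambda>u x. - laplace_beltrami u x - \<mu> * (1 / (bdist (cone_over S) x)\<^sup>2) * u x) (\<lambda>x. 1) S"

definition hardy_lambda :: "'a::euclidean_space set \<Rightarrow> real \<Rightarrow> ereal" where
  "hardy_lambda S \<mu> = (ereal ((2 - real DIM('a))\<^sup>2) + 4 * sigma S \<mu>) / 4"

end

theory Submission
  imports Defs
begin

text \<open>
  In logarithmic polar coordinates \<open>x = e\<^sup>t w\<close> a function \<open>|x|\<^bsup>(2-n)/2\<^esup> h(ln |x|) \<psi>(x/|x|)\<close> has the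
  energy \<open>\<integral>h'\<^sup>2 \<integral>\<psi>\<^sup>2 + \<integral>h\<^sup>2 (q(\<psi>) + (n-2)\<^sup>2/4 \<integral>\<psi>\<^sup>2)\<close>, where \<open>q\<close> is the form of \<open>-\<Delta>\<^sub>S - \<mu>/\<delta>\<^sup>2\<close> on
  the sphere. For \<open>\<mu> \<le> \<mu>\<^sub>0\<close> it is nonnegative, and stretching \<open>h\<close> gives \<open>\<sigma>(\<mu>) \<ge> -(n-2)\<^sup>2/4\<close>.
  Conversely, for a test function \<open>\<phi>\<close> on the cone the tangential part of the energy is bounded from
  below by applying the inequality defining \<open>\<sigma>(\<mu>)\<close> to every slice \<open>w \<mapsto> \<phi>(e\<^sup>t w)\<close>, and the radial
  part by the classical one-dimensional Hardy inequality, with constant \<open>(n-2)\<^sup>2/4\<close>.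
\<close>

section \<open>Gradients\<close>

text \<open>Integration by parts takes place in flat space only. A sphere integral is multiplied by
  the nonzero integral of a radial cutoff, the product is read as one integral over the whole space,
  and the factor is divided out again. This separates because everything is homogeneous: on a cone
  \<delta> has degree 1, so the potential and the squared gradient of a function of degree 0 both
  have degree -2. The exponent (2-n)/2 is the one for which the volume factor
  \<open>exp (n * t)\<close> cancels the radial weight of the energy; what remains of it is its
  square (n-2)^2/4 and a cross term h h', which is a total derivative. Replacing h(t) by h(e t)
  multiplies the ratio of the integrals of h'^2 and h^2 by e^2, so for e tending to 0 only the form
  on the sphere survives. The radial Hardy inequality produces the same square (n-2)^2/4, hence both
  halves speak of the single number \<lambda>(\<mu>) = (n-2)^2/4 + \<sigma>(\<mu>).\<close>

lemma partial_deriv_eqI: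
  assumes "(f has_derivative f') (at x)"
  shows "partial_deriv b f x = f' b"
  using frechet_derivative_at[OF assms] by (simp add: partial_deriv_def)

lemma grad_inner_Basis: "b \<in> Basis \<Longrightarrow> grad f x \<bullet> b = partial_deriv b f x"
  by (simp add: grad_def)

lemma inner_grad: "grad f x \<bullet> grad g x = (\<Sum>b\<in>Basis. partial_deriv b f x * partial_deriv b g x)"
  by (subst euclidean_inner) (simp add: grad_inner_Basis)

lemma grad_eqI:
  assumes "(f has_derivative (\<lambda>v. g \<bullet> v)) (at x)"
  shows "grad f x = g"
  by (rule euclidean_eqI) (simp add: grad_inner_Basis partial_deriv_eqI[OF assms])

lemma has_derivative_grad:
  assumes "f differentiable (at x)"
  shows "(f has_derivative (\<lambda>v. grad f x \<bullet> v)) (at x)"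
proof -
  obtain f' where f': "(f has_derivative f') (at x)"
    using assms by (auto simp: differentiable_def)
  interpret bounded_linear f'
    using f' by (rule has_derivative_bounded_linear)
  have "f' v = grad f x \<bullet> v" for v
  proof -
    have "f' v = f' (\<Sum>b\<in>Basis. (v \<bullet> b) *\<^sub>R b)"
      by (simp add: euclidean_representation)
    also have "\<dots> = (\<Sum>b\<in>Basis. (v \<bullet> b) * partial_deriv b f x)"
      unfolding sum by (simp add: scaleR partial_deriv_eqI[OF f'])
    also have "\<dots> = grad f x \<bullet> v"
      by (subst euclidean_inner) (simp add: grad_inner_Basis mult.commute)
    finally show ?thesis .
  qed
  then show ?thesis
    using f' by (metis (no_types) ext)
qed

lemma grad_mult:
  assumes "f differentiable (at x)" "g differentiable (at x)"
  shows "grad (\<lambda>y. f y * g y) x = f x *\<^sub>R grad g x + g x *\<^sub>R grad f x"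
  by (rule grad_eqI)
    (auto intro!: derivative_eq_intros has_derivative_grad[OF assms(1)] has_derivative_grad[OF assms(2)]
      simp: inner_simps algebra_simps)

lemma partial_deriv_zero_outside:
  assumes "closed K" "\<And>x. x \<notin> K \<Longrightarrow> f x = 0" "x \<notin> K"
  shows "partial_deriv b f x = 0"
proof -
  have "(f has_derivative (\<lambda>_. 0)) (at x)"
    by (rule has_derivative_transform_within_open[of "\<lambda>_. 0" _ x UNIV "- K"])
      (use assms in auto)
  from partial_deriv_eqI[OF this] show ?thesis .
qed

section \<open>Functions of class $C^k$\<close>

lemma Ck_on_subset: "Ck_on k U f \<Longrightarrow> V \<subseteq> U \<Longrightarrow> Ck_on k V f"
  by (induction k arbitrary: f) (auto intro: continuous_on_subset)

text \<open>No differentiability is required: \<open>frechet_derivative\<close> is a choice among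
  the derivatives at the point, and both functions have the same derivatives there, so even the
  arbitrary values agree.\<close>

lemma partial_deriv_cong_open:
  assumes "open U" "x \<in> U" "\<And>y. y \<in> U \<Longrightarrow> f y = g y"
  shows "partial_deriv b f x = partial_deriv b g x"
proof -
  have "(f has_derivative f') (at x) \<longleftrightarrow> (g has_derivative f') (at x)" for f'
    using has_derivative_transform_within_open[OF _ assms(1,2), of f f' UNIV g]
      has_derivative_transform_within_open[OF _ assms(1,2), of g f' UNIV f] assms(3) by metis
  then show ?thesis
    by (simp add: partial_deriv_def frechet_derivative_def)
qed

lemma differentiable_cong_open:
  assumes "open U" "x \<in> U" "\<And>y. y \<in> U \<Longrightarrow> f y = g y" "f differentiable (at x)"
  shows "g differentiable (at x)"
  using assms has_derivative_transform_within_open[OF _ assms(1,2), of f _ UNIV g]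
  unfolding differentiable_def by metis

lemma Ck_on_cong:
  assumes "open U" "Ck_on k U f" "\<And>x. x \<in> U \<Longrightarrow> f x = g x"
  shows "Ck_on k U g"
  using assms(2,3)
proof (induction k arbitrary: f g)
  case 0
  then show ?case by (simp cong: continuous_on_cong)
next
  case (Suc k)
  have "Ck_on k U (partial_deriv b g)" if "b \<in> Basis" for b
    using Suc.IH[of "partial_deriv b f" "partial_deriv b g"] Suc.prems that
      partial_deriv_cong_open[OF assms(1), of _ f g] by auto
  then show ?case
    using Suc.prems differentiable_cong_open[OF assms(1), of _ f g] by auto
qed

lemma Ck_on_Un:
  assumes "open U" "open V" "Ck_on k U f" "Ck_on k V f"
  shows "Ck_on k (U \<union> V) f"
  using assms(3,4) by (induction k arbitrary: f) (auto intro: continuous_on_open_Un assms)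

lemma Ck_on_SucD: "Ck_on (Suc k) U f \<Longrightarrow> Ck_on k U f"
proof (induction k arbitrary: f)
  case 0
  then show ?case
    by (auto intro!: differentiable_imp_continuous_on differentiable_at_imp_differentiable_on)
qed auto

lemma Ck_on_const: "Ck_on k U (\<lambda>_. c)"
proof (induction k arbitrary: c)
  case (Suc k)
  have "partial_deriv b (\<lambda>_. c) = (\<lambda>_. 0)" for b :: 'a
    by (rule ext) (rule partial_deriv_eqI[OF has_derivative_const])
  with Suc show ?case by auto
qed auto

lemma Ck_on_inner: "Ck_on k U (\<lambda>x. x \<bullet> a)"
proof (cases k)
  case (Suc k)
  have "partial_deriv b (\<lambda>x. x \<bullet> a) = (\<lambda>_. b \<bullet> a)" for b :: 'a
    by (rule ext, rule partial_deriv_eqI) (auto intro!: derivative_eq_intros)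
  with Suc show ?thesis by (auto intro: Ck_on_const)
qed (auto intro: continuous_intros)

lemma Ck_on_add:
  assumes "open U" "Ck_on k U f" "Ck_on k U g"
  shows "Ck_on k U (\<lambda>x. f x + g x)"
  using assms(2,3)
proof (induction k arbitrary: f g)
  case (Suc k)
  have "Ck_on k U (partial_deriv b (\<lambda>x. f x + g x))" if "b \<in> Basis" for b
  proof (rule Ck_on_cong[OF assms(1)])
    show "Ck_on k U (\<lambda>x. partial_deriv b f x + partial_deriv b g x)"
      using Suc that by auto
    fix x assume "x \<in> U"
    then have "((\<lambda>x. f x + g x) has_derivative (\<lambda>v. grad f x \<bullet> v + grad g x \<bullet> v)) (at x)"
      using Suc.prems by (auto intro!: derivative_eq_intros has_derivative_grad)
    from partial_deriv_eqI[OF this, of b] that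
    show "partial_deriv b f x + partial_deriv b g x = partial_deriv b (\<lambda>x. f x + g x) x"
      by (simp add: grad_inner_Basis)
  qed
  then show ?case using Suc.prems by auto
qed (auto intro: continuous_intros)

lemma partial_deriv_mult:
  assumes "f differentiable (at x)" "g differentiable (at x)" "b \<in> Basis"
  shows "partial_deriv b (\<lambda>y. f y * g y) x = f x * partial_deriv b g x + g x * partial_deriv b f x"
  using grad_mult[OF assms(1,2)] assms(3) grad_inner_Basis[OF assms(3), of "\<lambda>y. f y * g y" x]
  by (simp add: inner_simps grad_inner_Basis)

lemma Ck_on_mult:
  assumes "open U" "Ck_on k U f" "Ck_on k U g"
  shows "Ck_on k U (\<lambda>x. f x * g x)"
  using assms(2,3)
proof (induction k arbitrary: f g)
  case (Suc k)
  have "Ck_on k U (partial_deriv b (\<lambda>x. f x * g x))" if "b \<in> Basis" for b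
  proof (rule Ck_on_cong[OF assms(1)])
    show "Ck_on k U (\<lambda>x. f x * partial_deriv b g x + g x * partial_deriv b f x)"
      using Suc.prems that by (intro Ck_on_add Suc.IH assms Ck_on_SucD[of k U f] Ck_on_SucD[of k U g]) auto
    fix x assume "x \<in> U"
    then show "f x * partial_deriv b g x + g x * partial_deriv b f x = partial_deriv b (\<lambda>x. f x * g x) x"
      using Suc.prems that by (subst partial_deriv_mult) auto
  qed
  then show ?case using Suc.prems by auto
qed (auto intro: continuous_intros)

lemma Ck_on_sum:
  assumes "open U" "\<And>i. i \<in> I \<Longrightarrow> Ck_on k U (f i)"
  shows "Ck_on k U (\<lambda>x. \<Sum>i\<in>I. f i x)"
  using assms(2) by (induction I rule: infinite_finite_induct) (auto intro: Ck_on_const Ck_on_add assms)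

text \<open>By the chain rule a partial derivative is a sum of products of a derivative of
  \<open>f\<close> composed with the same \<open>h\<close> and a derivative of a component of
  \<open>h\<close>. Hence the induction varies \<open>f\<close> alone.\<close>

lemma Ck_on_compose:
  fixes h :: "'a::euclidean_space \<Rightarrow> 'b::euclidean_space"
  assumes "open U" "\<And>c. c \<in> Basis \<Longrightarrow> Ck_on k U (\<lambda>x. h x \<bullet> c)" "Ck_on k V f" "h ` U \<subseteq> V"
  shows "Ck_on k U (\<lambda>x. f (h x))"
  using assms(2,3)
proof (induction k arbitrary: f)
  case 0
  have "continuous_on U h"
    using 0 by (subst continuous_on_componentwise) auto
  with 0 show ?case
    using continuous_on_compose2[of V f U h] assms(4) by auto
next
  case (Suc k)
  have h: "h differentiable (at x)" if "x \<in> U" for x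
    using Suc.prems(1) that by (subst differentiable_componentwise_within) auto
  have f: "f differentiable (at (h x))" if "x \<in> U" for x
    using Suc.prems(2) that assms(4) by auto
  have "Ck_on k U (partial_deriv b (\<lambda>x. f (h x)))" if b: "b \<in> Basis" for b
  proof (rule Ck_on_cong[OF assms(1)])
    show "Ck_on k U (\<lambda>x. \<Sum>c\<in>Basis. partial_deriv c f (h x) * partial_deriv b (\<lambda>x. h x \<bullet> c) x)"
    proof (intro Ck_on_sum Ck_on_mult assms(1))
      fix c :: 'b assume c: "c \<in> Basis"
      show "Ck_on k U (\<lambda>x. partial_deriv c f (h x))"
        by (rule Suc.IH) (use Suc.prems c in \<open>auto intro: Ck_on_SucD\<close>)
      show "Ck_on k U (partial_deriv b (\<lambda>x. h x \<bullet> c))"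
        using Suc.prems(1)[OF c] b by auto
    qed
    fix x assume x: "x \<in> U"
    obtain h' where h': "(h has_derivative h') (at x)"
      using h[OF x] by (auto simp: differentiable_def)
    have 1: "((\<lambda>x. f (h x)) has_derivative (\<lambda>v. grad f (h x) \<bullet> h' v)) (at x)"
      using has_derivative_compose[OF h' has_derivative_grad[OF f[OF x]]] .
    have 2: "partial_deriv b (\<lambda>x. h x \<bullet> c) x = h' b \<bullet> c" for c
      by (rule partial_deriv_eqI) (auto intro!: derivative_eq_intros h')
    show "(\<Sum>c\<in>Basis. partial_deriv c f (h x) * partial_deriv b (\<lambda>x. h x \<bullet> c) x) =
        partial_deriv b (\<lambda>x. f (h x)) x"
      unfolding partial_deriv_eqI[OF 1] 2 by (subst euclidean_inner[of "grad f (h x)"]) (simp add: grad_inner_Basis)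
  qed
  moreover have "(\<lambda>x. f (h x)) differentiable (at x)" if "x \<in> U" for x
    using differentiable_compose[OF f[OF that] h[OF that]] .
  ultimately show ?case by auto
qed

lemma Ck_on_Suc_real:
  fixes f :: "real \<Rightarrow> real"
  assumes "open U" "\<And>t. t \<in> U \<Longrightarrow> (f has_real_derivative f' t) (at t)" "Ck_on k U f'"
  shows "Ck_on (Suc k) U f"
proof -
  have "Ck_on k U (partial_deriv 1 f)"
  proof (rule Ck_on_cong[OF assms(1,3)])
    fix t assume "t \<in> U"
    from partial_deriv_eqI[OF assms(2)[OF this, unfolded has_field_derivative_def], of 1]
    show "f' t = partial_deriv 1 f t" by simp
  qed
  then show ?thesis
    using assms(2) by (auto simp: real_differentiable_def)
qed

section \<open>Smooth functions\<close>

lemma smooth_on_subset: "smooth_on U f \<Longrightarrow> V \<subseteq> U \<Longrightarrow> smooth_on V f"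
  by (auto simp: smooth_on_def intro: Ck_on_subset)

lemma smooth_on_cong:
  "open U \<Longrightarrow> smooth_on U f \<Longrightarrow> (\<And>x. x \<in> U \<Longrightarrow> f x = g x) \<Longrightarrow> smooth_on U g"
  unfolding smooth_on_def using Ck_on_cong by blast

lemma smooth_on_const: "smooth_on U (\<lambda>_. c)"
  by (simp add: smooth_on_def Ck_on_const)

lemma smooth_on_inner: "smooth_on U (\<lambda>x. x \<bullet> a)"
  by (simp add: smooth_on_def Ck_on_inner)

lemma smooth_on_add: "open U \<Longrightarrow> smooth_on U f \<Longrightarrow> smooth_on U g \<Longrightarrow> smooth_on U (\<lambda>x. f x + g x)"
  by (simp add: smooth_on_def Ck_on_add)

lemma smooth_on_mult: "open U \<Longrightarrow> smooth_on U f \<Longrightarrow> smooth_on U g \<Longrightarrow> smooth_on U (\<lambda>x. f x * g x)"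
  by (simp add: smooth_on_def Ck_on_mult)

lemma smooth_on_power: "open U \<Longrightarrow> smooth_on U f \<Longrightarrow> smooth_on U (\<lambda>x. f x ^ m)"
  by (induction m) (auto intro: smooth_on_const smooth_on_mult)

lemma smooth_on_sum:
  "open U \<Longrightarrow> (\<And>i. i \<in> I \<Longrightarrow> smooth_on U (f i)) \<Longrightarrow> smooth_on U (\<lambda>x. \<Sum>i\<in>I. f i x)"
  by (simp add: smooth_on_def Ck_on_sum)

lemma smooth_on_compose:
  fixes h :: "'a::euclidean_space \<Rightarrow> 'b::euclidean_space"
  assumes "open U" "\<And>c. c \<in> Basis \<Longrightarrow> smooth_on U (\<lambda>x. h x \<bullet> c)" "smooth_on V f" "h ` U \<subseteq> V"
  shows "smooth_on U (\<lambda>x. f (h x))"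
  using assms unfolding smooth_on_def by (blast intro: Ck_on_compose)

lemma smooth_on_compose_real:
  fixes h :: "'a::euclidean_space \<Rightarrow> real"
  assumes "open U" "smooth_on U h" "smooth_on V f" "h ` U \<subseteq> V"
  shows "smooth_on U (\<lambda>x. f (h x))"
  by (rule smooth_on_compose) (use assms in auto)

lemma smooth_on_partial_deriv: "smooth_on U f \<Longrightarrow> b \<in> Basis \<Longrightarrow> smooth_on U (partial_deriv b f)"
  unfolding smooth_on_def by (metis Ck_on.simps(2))

lemma smooth_on_continuous_on: "smooth_on U f \<Longrightarrow> continuous_on U f"
  unfolding smooth_on_def by (metis Ck_on.simps(1))

lemma smooth_on_differentiable: "smooth_on U f \<Longrightarrow> x \<in> U \<Longrightarrow> f differentiable (at x)"
  unfolding smooth_on_def by (metis Ck_on.simps(2))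

lemma smooth_on_laplacian: "open U \<Longrightarrow> smooth_on U f \<Longrightarrow> smooth_on U (laplacian f)"
  unfolding laplacian_def[abs_def] by (intro smooth_on_sum smooth_on_partial_deriv)

lemma continuous_on_grad: "smooth_on U f \<Longrightarrow> continuous_on U (grad f)"
  unfolding grad_def[abs_def]
  by (intro continuous_intros smooth_on_continuous_on smooth_on_partial_deriv)

text \<open>\<open>U\<close> and the complement of \<open>K\<close> form an open cover of the space,
  and on the second set the function is constant.\<close>

lemma smooth_on_zero_extension:
  assumes "open U" "compact K" "K \<subseteq> U" "smooth_on U f" "\<And>x. x \<notin> K \<Longrightarrow> f x = 0"
  shows "smooth_on UNIV f"
proof -
  have "open (- K)"
    using assms(2) by (simp add: compact_imp_closed open_Compl)
  moreover from this have "smooth_on (- K) f"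
    by (rule smooth_on_cong[OF _ smooth_on_const[of _ 0]]) (use assms in auto)
  moreover have "U \<union> - K = UNIV"
    using assms(3) by auto
  ultimately show ?thesis
    using assms(1,4) Ck_on_Un[of U "- K" _ f] unfolding smooth_on_def by auto
qed

lemma smooth_on_powr: "smooth_on {0<..} (\<lambda>t::real. t powr a)"
proof -
  \<comment> \<open>The factor \<open>c\<close> and the free exponent make the family closed under
    differentiation.\<close>
  have "Ck_on k {0<..} (\<lambda>t::real. c * t powr a)" for k c
  proof (induction k arbitrary: a c)
    case (Suc k)
    show ?case
      by (rule Ck_on_Suc_real[OF _ _ Suc, of _ "c * a" "a - 1"]) (auto intro!: derivative_eq_intros)
  qed (auto intro!: continuous_intros)
  from this[of _ 1] show ?thesis
    by (simp add: smooth_on_def)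
qed

lemma smooth_on_ln: "smooth_on {0<..} (ln :: real \<Rightarrow> real)"
  unfolding smooth_on_def
proof
  fix k
  have "Ck_on (Suc k) {0<..} (ln :: real \<Rightarrow> real)"
  proof (rule Ck_on_Suc_real)
    show "Ck_on k {0<..} (\<lambda>t::real. t powr (-1))"
      using smooth_on_powr unfolding smooth_on_def by blast
  qed (auto intro!: derivative_eq_intros simp: powr_minus_divide)
  then show "Ck_on k {0<..} (ln :: real \<Rightarrow> real)"
    by (rule Ck_on_SucD)
qed

text \<open>The norm is traded for the polynomial x \<bullet> x, which is positive off the origin,
  raised to the power a/2.\<close>

lemma smooth_on_norm_powr: "smooth_on (- {0::'a::euclidean_space}) (\<lambda>x. norm x powr a)"
proof -
  have "smooth_on (- {0}) (\<lambda>x::'a. \<Sum>b\<in>Basis. (x \<bullet> b) * (x \<bullet> b))"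
    by (intro smooth_on_sum smooth_on_mult smooth_on_inner) auto
  then have sq: "smooth_on (- {0}) (\<lambda>x::'a. x \<bullet> x)"
    by (simp add: euclidean_inner[symmetric])
  have "smooth_on (- {0}) (\<lambda>x::'a. (x \<bullet> x) powr (a / 2))"
    by (rule smooth_on_compose_real[OF _ sq smooth_on_powr]) auto
  then show ?thesis
    by (rule smooth_on_cong[rotated]) (auto simp: norm_eq_sqrt_inner powr_half_sqrt[symmetric] powr_powr)
qed

lemma smooth_on_ln_norm: "smooth_on (- {0::'a::euclidean_space}) (\<lambda>x. ln (norm x))"
proof -
  have nrm: "smooth_on (- {0}) (\<lambda>x::'a. norm x)"
    by (rule smooth_on_cong[OF _ smooth_on_norm_powr[of 1]]) auto
  show ?thesis
    by (rule smooth_on_compose_real[OF _ nrm smooth_on_ln]) auto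
qed

lemma smooth_on_sgn_compose:
  assumes "smooth_on UNIV f"
  shows "smooth_on (- {0::'a::euclidean_space}) (\<lambda>x. f (s *\<^sub>R sgn x))"
proof (rule smooth_on_compose[OF _ _ assms])
  fix c :: 'a assume "c \<in> Basis"
  have "smooth_on (- {0::'a}) (\<lambda>x. s * (norm x powr (-1) * (x \<bullet> c)))"
    by (intro smooth_on_mult smooth_on_const smooth_on_norm_powr smooth_on_inner) auto
  then show "smooth_on (- {0::'a}) (\<lambda>x. (s *\<^sub>R sgn x) \<bullet> c)"
    by (rule smooth_on_cong[rotated]) (auto simp: sgn_div_norm powr_minus_divide divide_simps)
qed auto

section \<open>Integration by parts\<close>

lemma integrable_compact_support:
  fixes f :: "'a::euclidean_space \<Rightarrow> real"
  assumes "compact K" "continuous_on K f" "\<And>x. x \<notin> K \<Longrightarrow> f x = 0"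
  shows "integrable lborel f"
proof -
  have "integrable lborel (\<lambda>x. indicator K x *\<^sub>R f x)"
    using borel_integrable_compact[OF assms(1,2)] .
  also have "(\<lambda>x. indicator K x *\<^sub>R f x) = f"
    using assms(3) by (force simp: indicator_def)
  finally show ?thesis .
qed

text \<open>The difference quotients of \<open>f\<close> have integral zero by translation invariance.\<close>

lemma integral_partial_deriv_eq_0:
  fixes f :: "'a::euclidean_space \<Rightarrow> real"
  assumes f: "smooth_on UNIV f" and K: "compact K" "\<And>x. x \<notin> K \<Longrightarrow> f x = 0" and b: "b \<in> Basis"
  shows "(LINT x|lborel. partial_deriv b f x) = 0"
proof -
  have df: "f differentiable (at x)" for x
    using smooth_on_differentiable[OF f] by simp
  have cf: "continuous_on UNIV f"
    using f by (rule smooth_on_continuous_on)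
  have cd: "continuous_on UNIV (partial_deriv b f)"
    using smooth_on_continuous_on[OF smooth_on_partial_deriv[OF f b]] .
  have int: "integrable lborel f"
    using K continuous_on_subset[OF cf] by (intro integrable_compact_support[of K]) auto
  have zero: "grad f x = 0" if "x \<notin> K" for x
    using partial_deriv_zero_outside[OF compact_imp_closed[OF K(1)] K(2) that] by (simp add: grad_def)
  obtain C where C: "\<And>x. norm (grad f x) \<le> C"
  proof -
    have "bounded (grad f ` K)"
      using continuous_on_subset[OF continuous_on_grad[OF f]] K
      by (intro compact_imp_bounded compact_continuous_image) auto
    then obtain C where "0 < C" "\<And>x. x \<in> K \<Longrightarrow> norm (grad f x) \<le> C"
      by (auto simp: bounded_pos)
    then show ?thesis using that[of C] zero by (metis less_imp_le norm_zero)
  qed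
  \<comment> \<open>The Lipschitz bound dominates all difference quotients by the same
    constant.\<close>
  have lip: "\<bar>f y - f x\<bar> \<le> C * norm (y - x)" for x y
  proof -
    have "onorm (\<lambda>v. grad f x \<bullet> v) \<le> C" for x
    proof (rule onorm_le)
      fix v
      show "norm (grad f x \<bullet> v) \<le> C * norm v"
        using Cauchy_Schwarz_ineq2[of "grad f x" v] mult_right_mono[OF C[of x], of "norm v"] by simp
    qed
    then show ?thesis
      using differentiable_bound[of UNIV f "\<lambda>x v. grad f x \<bullet> v" C y x] has_derivative_grad[OF df]
      by simp
  qed
  define t :: "nat \<Rightarrow> real" where "t m = 1 / real (Suc m)" for m
  have t: "0 < t m" "t m \<le> 1" for m
    by (auto simp: t_def divide_simps)
  have "t \<longlonglongrightarrow> 0"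
    unfolding t_def using LIMSEQ_inverse_real_of_nat by (simp add: inverse_eq_divide)
  then have t0: "filterlim t (at 0) sequentially"
    using t(1) by (auto simp: filterlim_at intro!: always_eventually less_imp_neq[symmetric])
  define q where "q m x = (f (x + t m *\<^sub>R b) - f x) / t m" for m x
  \<comment> \<open>Sweeping \<open>K\<close> backwards along \<open>b\<close> by lengths up to 1
    gives one compact set outside which every quotient vanishes, since all step lengths
    \<open>t m\<close> are at most 1.\<close>
  define K' where "K' = {x + s *\<^sub>R (- b) |x s. x \<in> K \<and> s \<in> {0..1}}"
  have K': "compact K'"
  proof -
    have "compact {x + y |x y. x \<in> K \<and> y \<in> (\<lambda>s. s *\<^sub>R (- b)) ` {0..1::real}}"
      by (intro compact_sums K compact_continuous_image continuous_intros) auto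
    moreover have "{x + y |x y. x \<in> K \<and> y \<in> (\<lambda>s. s *\<^sub>R (- b)) ` {0..1::real}} = K'"
      unfolding K'_def by blast
    ultimately show ?thesis by simp
  qed
  have "K \<subseteq> K'"
    unfolding K'_def by (force intro: exI[of _ "0::real"])
  have "(\<lambda>m. LINT x|lborel. q m x) \<longlonglongrightarrow> (LINT x|lborel. partial_deriv b f x)"
  proof (rule integral_dominated_convergence[where w="\<lambda>x. indicator K' x * C"])
    show "partial_deriv b f \<in> borel_measurable lborel"
      using borel_measurable_continuous_onI[OF cd] by simp
    have "continuous_on UNIV (q m)" for m
      unfolding q_def using t(1)[of m]
      by (intro continuous_intros continuous_on_compose2[OF cf]) auto
    then show "q m \<in> borel_measurable lborel" for m
      using borel_measurable_continuous_onI by auto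
    show "integrable lborel (\<lambda>x. indicator K' x * C)"
      using K' by (intro integrable_mult_left) (auto intro!: integrable_real_indicator emeasure_bounded_finite compact_imp_bounded simp: compact_imp_closed borel_closed)
    show "AE x in lborel. (\<lambda>m. q m x) \<longlonglongrightarrow> partial_deriv b f x"
    proof (rule AE_I2)
      fix x
      have "((\<lambda>s. f (x + s *\<^sub>R b)) has_derivative (\<lambda>s. grad f x \<bullet> (s *\<^sub>R b))) (at 0)"
        by (rule has_derivative_compose[where g=f])
          (auto intro!: derivative_eq_intros has_derivative_grad[OF df])
      then have "((\<lambda>s. f (x + s *\<^sub>R b)) has_real_derivative partial_deriv b f x) (at 0)"
        using b by (simp add: has_field_derivative_def grad_inner_Basis mult_commute_abs)
      then have "((\<lambda>s. (f (x + s *\<^sub>R b) - f x) / s) \<longlongrightarrow> partial_deriv b f x) (at 0)"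
        by (simp add: has_field_derivative_iff)
      from filterlim_compose[OF this t0] show "(\<lambda>m. q m x) \<longlonglongrightarrow> partial_deriv b f x"
        by (simp add: q_def)
    qed
    fix m
    show "AE x in lborel. norm (q m x) \<le> indicator K' x * C"
    proof (rule AE_I2)
      fix x
      show "norm (q m x) \<le> indicator K' x * C"
      proof (cases "x \<in> K'")
        case True
        then show ?thesis
          using lip[of "x + t m *\<^sub>R b" x] t[of m] b by (simp add: q_def divide_simps)
      next
        case False
        have "x + t m *\<^sub>R b \<notin> K"
        proof
          assume "x + t m *\<^sub>R b \<in> K"
          then have "x + t m *\<^sub>R b + t m *\<^sub>R (- b) \<in> K'"
            using t[of m] unfolding K'_def by (intro CollectI exI conjI refl) auto
          with False show False by simp
        qed
        then show ?thesis
          using False K(2) \<open>K \<subseteq> K'\<close> by (auto simp: q_def)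
      qed
    qed
  qed
  moreover have "(LINT x|lborel. q m x) = 0" for m
  proof -
    have tr: "integrable lborel (\<lambda>x. f (x + t m *\<^sub>R b))"
      using int integrable_distr[of "(+) (t m *\<^sub>R b)" lborel borel f]
      by (simp add: lborel_distr_plus add.commute)
    have "(LINT x|lborel. f (x + t m *\<^sub>R b)) = (LINT x|lborel. f x)"
      using integral_distr[of "(+) (t m *\<^sub>R b)" lborel borel f] borel_measurable_continuous_onI[OF cf]
      by (simp add: lborel_distr_plus add.commute)
    then show ?thesis
      using int tr by (simp add: q_def diff_divide_distrib)
  qed
  ultimately have "(\<lambda>m. 0) \<longlonglongrightarrow> (LINT x|lborel. partial_deriv b f x)"
    by simp
  then show ?thesis
    using LIMSEQ_unique[OF _ tendsto_const] by blast
qed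

text \<open>For each \<open>b\<close> the field component u \<partial>v/\<partial>b vanishes off
  \<open>K\<close>, so its zero extension is smooth and its derivative integrates to 0. Smoothness
  is asked for on \<open>U\<close> only because \<open>v\<close> will be singular at the origin: a
  function of degree 0, or the logarithm of the norm.\<close>

lemma green_formula:
  fixes u v :: "'a::euclidean_space \<Rightarrow> real"
  assumes U: "open U" and K: "compact K" "K \<subseteq> U" and u: "smooth_on U u" "\<And>x. x \<notin> K \<Longrightarrow> u x = 0"
    and v: "smooth_on U v"
  shows "(LINT x|lborel. u x * laplacian v x) = - (LINT x|lborel. grad u x \<bullet> grad v x)"
proof -
  have cont: "continuous_on K f" if "smooth_on U f" for f
    using smooth_on_continuous_on[OF that] K(2) continuous_on_subset by blast
  have zu: "partial_deriv b u x = 0" if "x \<notin> K" for b x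
    using partial_deriv_zero_outside[OF compact_imp_closed[OF K(1)] u(2) that] by auto
  have i1: "integrable lborel (\<lambda>x. u x * partial_deriv b (partial_deriv b v) x)"
    and i2: "integrable lborel (\<lambda>x. partial_deriv b u x * partial_deriv b v x)"
    and eq: "(LINT x|lborel. u x * partial_deriv b (partial_deriv b v) x) =
       - (LINT x|lborel. partial_deriv b u x * partial_deriv b v x)" if b: "b \<in> Basis" for b
  proof -
    note s = smooth_on_partial_deriv[OF u(1) b] smooth_on_partial_deriv[OF v b]
      smooth_on_partial_deriv[OF smooth_on_partial_deriv[OF v b] b]
    show i1: "integrable lborel (\<lambda>x. u x * partial_deriv b (partial_deriv b v) x)"
      by (rule integrable_compact_support[OF K(1)]) (simp_all add: u(2), intro continuous_on_mult cont s u(1))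
    show i2: "integrable lborel (\<lambda>x. partial_deriv b u x * partial_deriv b v x)"
      by (rule integrable_compact_support[OF K(1)]) (simp_all add: zu, intro continuous_on_mult cont s)
    have "smooth_on U (\<lambda>x. u x * partial_deriv b v x)"
      by (intro smooth_on_mult s u U)
    then have sm: "smooth_on UNIV (\<lambda>x. u x * partial_deriv b v x)"
      by (rule smooth_on_zero_extension[OF U K]) (simp add: u)
    have "0 = (LINT x|lborel. partial_deriv b (\<lambda>x. u x * partial_deriv b v x) x)"
      by (rule integral_partial_deriv_eq_0[OF sm K(1) _ b, symmetric]) (simp add: u)
    also have "\<dots> = (LINT x|lborel. u x * partial_deriv b (partial_deriv b v) x + partial_deriv b u x * partial_deriv b v x)"
    proof (rule Bochner_Integration.integral_cong[OF refl])
      fix x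
      show "partial_deriv b (\<lambda>x. u x * partial_deriv b v x) x =
        u x * partial_deriv b (partial_deriv b v) x + partial_deriv b u x * partial_deriv b v x"
      proof (cases "x \<in> K")
        case True
        then have "x \<in> U" using K by auto
        then show ?thesis
          using smooth_on_differentiable[OF u(1)] smooth_on_differentiable[OF s(2)] b
          by (subst partial_deriv_mult) auto
      next
        case False
        then show ?thesis
          using partial_deriv_zero_outside[OF compact_imp_closed[OF K(1)], of "\<lambda>x. u x * partial_deriv b v x" x b]
          by (simp add: u zu)
      qed
    qed
    also have "\<dots> = (LINT x|lborel. u x * partial_deriv b (partial_deriv b v) x) +
        (LINT x|lborel. partial_deriv b u x * partial_deriv b v x)"
      using i1 i2 by simp
    finally show "(LINT x|lborel. u x * partial_deriv b (partial_deriv b v) x) =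
       - (LINT x|lborel. partial_deriv b u x * partial_deriv b v x)" by simp
  qed
  have "(LINT x|lborel. u x * laplacian v x) =
      (LINT x|lborel. (\<Sum>b\<in>Basis. u x * partial_deriv b (partial_deriv b v) x))"
    by (simp add: laplacian_def sum_distrib_left)
  also have "\<dots> = (\<Sum>b\<in>Basis. (LINT x|lborel. u x * partial_deriv b (partial_deriv b v) x))"
    using i1 by (rule Bochner_Integration.integral_sum)
  also have "\<dots> = - (\<Sum>b\<in>Basis. (LINT x|lborel. partial_deriv b u x * partial_deriv b v x))"
    by (simp add: eq sum_negf)
  also have "\<dots> = - (LINT x|lborel. (\<Sum>b\<in>Basis. partial_deriv b u x * partial_deriv b v x))"
    using i2 by (subst Bochner_Integration.integral_sum) auto
  finally show ?thesis
    by (simp add: inner_grad)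
qed

section \<open>Logarithmic polar coordinates\<close>

lemma nn_integral_surface_measure:
  fixes f :: "'a::euclidean_space \<Rightarrow> ennreal"
  assumes [measurable]: "f \<in> borel_measurable borel"
  shows "(\<integral>\<^sup>+ w. f w \<partial>surface_measure) =
    of_nat DIM('a) * (\<integral>\<^sup>+ x. f (sgn x) * indicator (ball 0 1 - {0}) x \<partial>lborel)"
proof -
  have [measurable]: "sgn \<in> measurable (restrict_space lborel (ball 0 1 - {0::'a})) borel"
    using measurable_sgn_euclidean by (intro measurable_restrict_space1) auto
  show ?thesis
    unfolding surface_measure_def
    by (simp add: nn_integral_scale_measure nn_integral_distr nn_integral_restrict_space)
qed

lemma space_surface_measure [simp]: "space surface_measure = UNIV"
  by (simp add: surface_measure_def space_scale_measure)

lemma sets_surface_measure [simp, measurable_cong]: "sets surface_measure = sets borel"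
  by (simp add: surface_measure_def)

lemma finite_measure_surface_measure: "finite_measure (surface_measure :: 'a::euclidean_space measure)"
proof
  have "emeasure lborel {x \<in> ball 0 1 - {0::'a}. sgn x \<in> UNIV} \<le> emeasure lborel (ball 0 1 :: 'a set)"
    by (intro emeasure_mono) auto
  also have "\<dots> < \<infinity>"
    by (rule emeasure_bounded_finite) simp
  finally show "emeasure (surface_measure :: 'a measure) (space surface_measure) \<noteq> \<infinity>"
    by (subst space_surface_measure, subst emeasure_surface_measure)
      (auto simp: ennreal_mult_eq_top_iff)
qed

lemma nn_integral_lborel_scale:
  fixes f :: "'a::euclidean_space \<Rightarrow> ennreal"
  assumes [measurable]: "f \<in> borel_measurable borel" and "0 < c"
  shows "(\<integral>\<^sup>+ x. f x \<partial>lborel) = ennreal (c ^ DIM('a)) * (\<integral>\<^sup>+ x. f (c *\<^sub>R x) \<partial>lborel)"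
  using assms(2)
  by (subst lborel_affine[of c 0]) (auto simp: nn_integral_density nn_integral_distr nn_integral_cmult)

lemma nn_integral_exp_tail:
  assumes "0 < n"
  shows "(\<integral>\<^sup>+ t. ennreal (exp (- real n * t)) * indicator {a<..} t \<partial>lborel) = ennreal (exp (- real n * a) / n)"
proof -
  have "(\<integral>\<^sup>+ t. ennreal (exp (- real n * t)) * indicator {a<..} t \<partial>lborel) =
     (\<integral>\<^sup>+ t. ennreal (exp (- real n * t)) * indicator {a..} t \<partial>lborel)"
    by (rule nn_integral_cong_AE, rule AE_mp[OF AE_lborel_singleton[of a]])
      (auto split: split_indicator)
  also have "\<dots> = ennreal (0 - (- exp (- real n * a) / n))"
  proof (rule nn_integral_FTC_atLeast)
    have "LIM t at_top. - real n * t :> at_bot"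
      using assms by (intro filterlim_tendsto_neg_mult_at_bot[OF tendsto_const]) (auto intro: filterlim_ident)
    then have "((\<lambda>t. exp (- real n * t)) \<longlongrightarrow> 0) at_top"
      by (rule filterlim_compose[OF exp_at_bot])
    then show "((\<lambda>t. - exp (- real n * t) / n) \<longlongrightarrow> 0) at_top"
      using tendsto_divide[OF tendsto_minus tendsto_const] assms by force
  qed (use assms in \<open>auto intro!: derivative_eq_intros\<close>)
  finally show ?thesis by simp
qed

text \<open>The surface measure is given by volumes in the unit ball, so the right-hand side is a
  double integral over t and the ball. A translation in t, a dilation in space and exchanges of the
  order of integration turn it into the left-hand side, without a Jacobian of polar
  coordinates.\<close>

lemma nn_integral_polar:
  fixes f :: "'a::euclidean_space \<Rightarrow> ennreal"
  assumes [measurable]: "f \<in> borel_measurable borel"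
  shows "(\<integral>\<^sup>+ x. f x \<partial>lborel) =
    (\<integral>\<^sup>+ t. ennreal (exp (real DIM('a) * t)) *
       (\<integral>\<^sup>+ w. f (exp t *\<^sub>R w) * indicator (sphere 0 1) w \<partial>surface_measure) \<partial>lborel)"
proof -
  let ?n = "DIM('a)"
  let ?B = "ball 0 1 - {0::'a}"
  have [measurable]: "(sgn :: 'a \<Rightarrow> 'a) \<in> borel_measurable borel"
    by (rule measurable_sgn_euclidean)
  have [measurable]: "?B \<in> sets borel" "sphere 0 1 \<in> sets (borel :: 'a measure)" by auto
  have "(\<integral>\<^sup>+ t. ennreal (exp (real ?n * t)) *
       (\<integral>\<^sup>+ w. f (exp t *\<^sub>R w) * indicator (sphere 0 1) w \<partial>surface_measure) \<partial>lborel) =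
    (\<integral>\<^sup>+ t. of_nat ?n * (\<integral>\<^sup>+ x. ennreal (exp (real ?n * t)) * f (exp t *\<^sub>R sgn x) * indicator ?B x \<partial>lborel) \<partial>lborel)"
  proof (rule nn_integral_cong)
    fix t
    have "(\<integral>\<^sup>+ w. f (exp t *\<^sub>R w) * indicator (sphere 0 1) w \<partial>surface_measure) =
      of_nat ?n * (\<integral>\<^sup>+ x. f (exp t *\<^sub>R sgn x) * indicator (sphere 0 1) (sgn x) * indicator ?B x \<partial>lborel)"
      by (rule nn_integral_surface_measure) measurable
    also have "(\<integral>\<^sup>+ x. f (exp t *\<^sub>R sgn x) * indicator (sphere 0 1) (sgn x) * indicator ?B x \<partial>lborel) =
      (\<integral>\<^sup>+ x. f (exp t *\<^sub>R sgn x) * indicator ?B x \<partial>lborel)"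
      by (rule nn_integral_cong) (auto simp: norm_sgn split: split_indicator)
    finally show "ennreal (exp (real ?n * t)) *
       (\<integral>\<^sup>+ w. f (exp t *\<^sub>R w) * indicator (sphere 0 1) w \<partial>surface_measure) =
      of_nat ?n * (\<integral>\<^sup>+ x. ennreal (exp (real ?n * t)) * f (exp t *\<^sub>R sgn x) * indicator ?B x \<partial>lborel)"
      by (simp add: nn_integral_cmult[symmetric] mult_ac)
  qed
  also have "\<dots> = of_nat ?n * (\<integral>\<^sup>+ t. (\<integral>\<^sup>+ x. ennreal (exp (real ?n * t)) * f (exp t *\<^sub>R sgn x) * indicator ?B x \<partial>lborel) \<partial>lborel)"
    by (rule nn_integral_cmult) measurable
  also have "(\<integral>\<^sup>+ t. (\<integral>\<^sup>+ x. ennreal (exp (real ?n * t)) * f (exp t *\<^sub>R sgn x) * indicator ?B x \<partial>lborel) \<partial>lborel) =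
     (\<integral>\<^sup>+ x. (\<integral>\<^sup>+ t. ennreal (exp (real ?n * t)) * f (exp t *\<^sub>R sgn x) * indicator ?B x \<partial>lborel) \<partial>lborel)"
    by (rule lborel_pair.Fubini') measurable
  \<comment> \<open>For fixed x, translating t by ln |x| turns \<open>exp t *\<^sub>R sgn x\<close>
    into \<open>exp t *\<^sub>R x\<close>, at the price of the factor |x|^n.\<close>
  also have "\<dots> = (\<integral>\<^sup>+ x. (\<integral>\<^sup>+ t. ennreal (exp (real ?n * t)) * ennreal (norm x ^ ?n) * f (exp t *\<^sub>R x) * indicator ?B x \<partial>lborel) \<partial>lborel)"
  proof (rule nn_integral_cong)
    fix x :: 'a
    show "(\<integral>\<^sup>+ t. ennreal (exp (real ?n * t)) * f (exp t *\<^sub>R sgn x) * indicator ?B x \<partial>lborel) =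
      (\<integral>\<^sup>+ t. ennreal (exp (real ?n * t)) * ennreal (norm x ^ ?n) * f (exp t *\<^sub>R x) * indicator ?B x \<partial>lborel)"
    proof (cases "x = 0")
      case False
      have e: "exp (real ?n * (ln (norm x) + t)) = exp (real ?n * t) * norm x ^ ?n" for t
        using False by (simp add: distrib_left exp_add exp_of_nat_mult)
      have "exp (ln (norm x) + t) *\<^sub>R sgn x = exp t *\<^sub>R x" for t
        using False by (simp add: exp_add sgn_div_norm)
      then show ?thesis
        by (subst nn_integral_real_affine[where c=1 and t="ln (norm x)"]) (auto simp: e ennreal_mult)
    qed auto
  qed
  also have "\<dots> = (\<integral>\<^sup>+ t. (\<integral>\<^sup>+ x. ennreal (exp (real ?n * t)) * ennreal (norm x ^ ?n) * f (exp t *\<^sub>R x) * indicator ?B x \<partial>lborel) \<partial>lborel)"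
    by (rule lborel_pair.Fubini') measurable
  \<comment> \<open>For fixed t, substitute y = exp(t) x; the condition |x| < 1 becomes ln |y| <
    t.\<close>
  also have "\<dots> = (\<integral>\<^sup>+ t. (\<integral>\<^sup>+ y. ennreal (exp (- real ?n * t)) * ennreal (norm y ^ ?n) * f y * indicator {z. z \<noteq> 0 \<and> ln (norm z) < t} y \<partial>lborel) \<partial>lborel)"
  proof (rule nn_integral_cong)
    fix t :: real
    have "(\<integral>\<^sup>+ y. ennreal (exp (- real ?n * t)) * ennreal (norm y ^ ?n) * f y * indicator {z. z \<noteq> 0 \<and> ln (norm z) < t} y \<partial>lborel) =
      ennreal (exp t ^ ?n) * (\<integral>\<^sup>+ x. ennreal (exp (- real ?n * t)) * ennreal (norm (exp t *\<^sub>R x) ^ ?n) * f (exp t *\<^sub>R x) * indicator {z. z \<noteq> 0 \<and> ln (norm z) < t} (exp t *\<^sub>R x) \<partial>lborel)"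
      by (rule nn_integral_lborel_scale) (auto intro: measurable_compose_rev)
    also have "\<dots> = (\<integral>\<^sup>+ x. ennreal (exp t ^ ?n) * (ennreal (exp (- real ?n * t)) * ennreal (norm (exp t *\<^sub>R x) ^ ?n) * f (exp t *\<^sub>R x) * indicator {z. z \<noteq> 0 \<and> ln (norm z) < t} (exp t *\<^sub>R x)) \<partial>lborel)"
      by (rule nn_integral_cmult[symmetric]) measurable
    also have "\<dots> = (\<integral>\<^sup>+ x. ennreal (exp (real ?n * t)) * ennreal (norm x ^ ?n) * f (exp t *\<^sub>R x) * indicator ?B x \<partial>lborel)"
    proof (rule nn_integral_cong)
      fix x :: 'a
      have 1: "indicator {z. z \<noteq> 0 \<and> ln (norm z) < t} (exp t *\<^sub>R x) = (indicator ?B x :: ennreal)"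
        by (auto simp: ln_mult split: split_indicator)
      have 2: "ennreal (exp t ^ ?n) * (ennreal (exp (- real ?n * t)) * ennreal (norm (exp t *\<^sub>R x) ^ ?n)) =
        ennreal (exp (real ?n * t)) * ennreal (norm x ^ ?n)"
        by (simp add: ennreal_mult[symmetric] power_mult_distrib exp_minus exp_of_nat_mult[symmetric] field_simps)
      show "ennreal (exp t ^ ?n) * (ennreal (exp (- real ?n * t)) * ennreal (norm (exp t *\<^sub>R x) ^ ?n) * f (exp t *\<^sub>R x) * indicator {z. z \<noteq> 0 \<and> ln (norm z) < t} (exp t *\<^sub>R x)) =
        ennreal (exp (real ?n * t)) * ennreal (norm x ^ ?n) * f (exp t *\<^sub>R x) * indicator ?B x"
        unfolding 1 2[symmetric] by (simp only: mult.assoc)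
    qed
    finally show "(\<integral>\<^sup>+ x. ennreal (exp (real ?n * t)) * ennreal (norm x ^ ?n) * f (exp t *\<^sub>R x) * indicator ?B x \<partial>lborel) =
      (\<integral>\<^sup>+ y. ennreal (exp (- real ?n * t)) * ennreal (norm y ^ ?n) * f y * indicator {z. z \<noteq> 0 \<and> ln (norm z) < t} y \<partial>lborel)" ..
  qed
  also have "\<dots> = (\<integral>\<^sup>+ y. (\<integral>\<^sup>+ t. ennreal (exp (- real ?n * t)) * ennreal (norm y ^ ?n) * f y * indicator {z. z \<noteq> 0 \<and> ln (norm z) < t} y \<partial>lborel) \<partial>lborel)"
    by (rule lborel_pair.Fubini') measurable
  \<comment> \<open>Only the exponential and the condition t > ln |y| depend on t; the integral over
    this tail is |y|^(-n) / n. It cancels |y|^n, and the 1/n is absorbed by the factor n in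
    \<open>surface_measure\<close>.\<close>
  also have "\<dots> = (\<integral>\<^sup>+ y. ennreal (1 / ?n) * f y \<partial>lborel)"
  proof (rule nn_integral_cong_AE, rule AE_mp[OF AE_lborel_singleton[of 0]], rule AE_I2, rule impI)
    fix y :: 'a assume y: "y \<noteq> 0"
    have "(\<integral>\<^sup>+ t. ennreal (exp (- real ?n * t)) * ennreal (norm y ^ ?n) * f y * indicator {z. z \<noteq> 0 \<and> ln (norm z) < t} y \<partial>lborel) =
      (\<integral>\<^sup>+ t. (ennreal (norm y ^ ?n) * f y) * (ennreal (exp (- real ?n * t)) * indicator {ln (norm y)<..} t) \<partial>lborel)"
      using y by (intro nn_integral_cong) (auto split: split_indicator simp: mult_ac)
    also have "\<dots> = (ennreal (norm y ^ ?n) * f y) * ennreal (exp (- real ?n * ln (norm y)) / ?n)"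
      by (subst nn_integral_cmult, measurable, subst nn_integral_exp_tail) auto
    also have "\<dots> = (ennreal (norm y ^ ?n) * ennreal (exp (- real ?n * ln (norm y)) / ?n)) * f y"
      by (simp only: mult_ac)
    also have "ennreal (norm y ^ ?n) * ennreal (exp (- real ?n * ln (norm y)) / ?n) = ennreal (1 / ?n)"
      using y by (simp add: ennreal_mult[symmetric] exp_minus exp_of_nat_mult)
    finally show "(\<integral>\<^sup>+ t. ennreal (exp (- real ?n * t)) * ennreal (norm y ^ ?n) * f y * indicator {z. z \<noteq> 0 \<and> ln (norm z) < t} y \<partial>lborel) =
      ennreal (1 / ?n) * f y" .
  qed
  also have "of_nat ?n * \<dots> = of_nat ?n * ennreal (1 / ?n) * (\<integral>\<^sup>+ y. f y \<partial>lborel)"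
    by (simp add: nn_integral_cmult mult.assoc)
  also have "of_nat ?n * ennreal (1 / ?n) = 1"
    by (simp add: ennreal_of_nat_eq_real_of_nat ennreal_mult[symmetric])
  finally show ?thesis by simp
qed

text \<open>An identity of measures lets integrability of signed functions pass to polar
  coordinates, so that Fubini for the Bochner integral applies.\<close>

lemma lborel_eq_distr_polar:
  "(lborel :: 'a::euclidean_space measure) =
    distr (density (lborel \<Otimes>\<^sub>M surface_measure)
        (\<lambda>(t, w). ennreal (exp (real DIM('a) * t) * indicator (sphere 0 1) w)))
      borel (\<lambda>(t, w). exp t *\<^sub>R w)" (is "_ = distr ?M _ ?g")
proof (rule measure_eqI)
  interpret S: finite_measure "surface_measure :: 'a measure"
    by (rule finite_measure_surface_measure)
  fix A :: "'a set" assume "A \<in> sets lborel"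
  then have [measurable]: "A \<in> sets borel" by simp
  have [measurable]: "sphere 0 1 \<in> sets (borel :: 'a measure)" by auto
  have "emeasure lborel A = (\<integral>\<^sup>+ x. indicator A x \<partial>lborel)"
    by simp
  also have "\<dots> = (\<integral>\<^sup>+ t. ennreal (exp (real DIM('a) * t)) *
       (\<integral>\<^sup>+ w. indicator A (exp t *\<^sub>R w) * indicator (sphere 0 1) w \<partial>surface_measure) \<partial>lborel)"
    by (rule nn_integral_polar) measurable
  also have "\<dots> = (\<integral>\<^sup>+ t. (\<integral>\<^sup>+ w. ennreal (exp (real DIM('a) * t) * indicator (sphere 0 1) w) * indicator A (exp t *\<^sub>R w) \<partial>surface_measure) \<partial>lborel)"
    by (rule nn_integral_cong, subst nn_integral_cmult[symmetric])
      (auto intro!: nn_integral_cong simp: ennreal_mult split: split_indicator)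
  also have "\<dots> = (\<integral>\<^sup>+ p. (case p of (t, w) \<Rightarrow> ennreal (exp (real DIM('a) * t) * indicator (sphere 0 1) w) * indicator A (exp t *\<^sub>R w)) \<partial>(lborel \<Otimes>\<^sub>M surface_measure))"
    by (subst S.nn_integral_fst[symmetric]) auto
  also have "\<dots> = (\<integral>\<^sup>+ x. indicator A x \<partial>distr ?M borel ?g)"
    by (subst nn_integral_distr, measurable, subst nn_integral_density)
      (auto intro!: nn_integral_cong simp: case_prod_beta')
  also have "\<dots> = emeasure (distr ?M borel ?g) A"
    by simp
  finally show "emeasure lborel A = emeasure (distr ?M borel ?g) A" .
qed simp

lemma integral_polar:
  fixes f :: "'a::euclidean_space \<Rightarrow> real"
  assumes "integrable lborel f"
  shows "(LINT x|lborel. f x) =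
    (LINT t|lborel. exp (real DIM('a) * t) * (LINT w:sphere 0 1|surface_measure. f (exp t *\<^sub>R w)))"
proof -
  interpret S: finite_measure "surface_measure :: 'a measure"
    by (rule finite_measure_surface_measure)
  interpret P: pair_sigma_finite "lborel :: real measure" "surface_measure :: 'a measure" ..
  have [measurable]: "f \<in> borel_measurable borel"
    using assms by auto
  have [measurable]: "sphere 0 1 \<in> sets (borel :: 'a measure)" by auto
  let ?d = "\<lambda>(t, w::'a). exp (real DIM('a) * t) * indicator (sphere 0 1) w :: real"
  let ?M = "density (lborel \<Otimes>\<^sub>M surface_measure) (\<lambda>p. ennreal (?d p))"
  have M: "(lborel :: 'a measure) = distr ?M borel (\<lambda>(t, w). exp t *\<^sub>R w)"
    using lborel_eq_distr_polar[where 'a='a] by (simp add: case_prod_beta')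
  have int: "integrable ?M (\<lambda>(t, w). f (exp t *\<^sub>R w))"
    using assms by (subst (asm) M, subst (asm) integrable_distr_eq) (auto simp: case_prod_beta')
  then have int2: "integrable (lborel \<Otimes>\<^sub>M surface_measure) (\<lambda>(t, w). ?d (t, w) * f (exp t *\<^sub>R w))"
    by (subst (asm) integrable_density) (auto simp: case_prod_beta')
  have "(LINT x|lborel. f x) = (LINT p|?M. (case p of (t, w) \<Rightarrow> f (exp t *\<^sub>R w)))"
    by (subst M, subst integral_distr) (auto simp: case_prod_beta')
  also have "\<dots> = (LINT p|(lborel \<Otimes>\<^sub>M surface_measure). (case p of (t, w) \<Rightarrow> ?d (t, w) * f (exp t *\<^sub>R w)))"
    by (subst integral_density) (auto simp: case_prod_beta')
  also have "\<dots> = (LINT t|lborel. (LINT w|surface_measure. ?d (t, w) * f (exp t *\<^sub>R w)))"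
    using P.integral_fst'[OF int2] by simp
  also have "\<dots> = (LINT t|lborel. exp (real DIM('a) * t) * (LINT w:sphere 0 1|surface_measure. f (exp t *\<^sub>R w)))"
    by (simp add: set_lebesgue_integral_def mult.assoc)
  finally show ?thesis .
qed

section \<open>A smooth bump function\<close>

lemma power_le_fact_exp:
  assumes "0 \<le> (u::real)"
  shows "u ^ m \<le> fact m * exp u"
proof -
  \<comment> \<open>One term of the exponential series is at most its sum.\<close>
  have "(\<Sum>k\<in>{m}. u ^ k /\<^sub>R fact k) \<le> exp u"
    unfolding exp_def using assms by (intro sum_le_suminf summable_exp_generic) auto
  then show ?thesis
    by (simp add: divide_simps mult.commute)
qed

text \<open>The derivatives of exp(-1/t) are linear combinations of members of this family, so a
  single induction over the order of differentiation, with \<open>m\<close> arbitrary, shows that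
  all of them are smooth.\<close>

definition exp_inv :: "nat \<Rightarrow> real \<Rightarrow> real" where
  "exp_inv m t = (if 0 < t then exp (- 1 / t) * (1 / t) ^ m else 0)"

text \<open>With u = 1/t this is u^(m+2) \<le> (m+2)! exp(u). The two extra powers give decay of
  order t^2, which makes the difference quotient at 0 tend to 0.\<close>

lemma exp_inv_bound: "\<bar>exp_inv m t\<bar> \<le> fact (m + 2) * t\<^sup>2"
proof (cases "0 < t")
  case True
  have "(1 / t) ^ (m + 2) \<le> fact (m + 2) * exp (1 / t)"
    using True by (intro power_le_fact_exp) auto
  then have "(1 / t) ^ m * exp (- 1 / t) \<le> fact (m + 2) * t\<^sup>2"
    using True by (simp add: power_add divide_simps exp_minus power2_eq_square mult_ac)
  then show ?thesis
    using True by (simp add: exp_inv_def mult.commute)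
qed (auto simp: exp_inv_def)

lemma exp_inv_has_derivative:
  "(exp_inv m has_real_derivative exp_inv (m + 2) t + (- real m) * exp_inv (m + 1) t) (at t)"
proof (cases t "0::real" rule: linorder_cases)
  case less
  have "(exp_inv m has_real_derivative 0) (at t)"
    by (rule has_field_derivative_transform_within_open[of "\<lambda>_. 0" _ _ "{..<0}"]) (use less in \<open>auto simp: exp_inv_def\<close>)
  then show ?thesis
    using less by (simp add: exp_inv_def)
next
  case equal
  have "((\<lambda>s. exp_inv m s / s) \<longlongrightarrow> 0) (at 0)"
  proof (rule Lim_null_comparison)
    have "norm (exp_inv m s / s) \<le> fact (m + 2) * \<bar>s\<bar>" if "s \<noteq> 0" for s
    proof -
      have "\<bar>exp_inv m s\<bar> \<le> fact (m + 2) * \<bar>s\<bar> * \<bar>s\<bar>"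
        using exp_inv_bound[of m s] by (simp add: power2_eq_square mult.assoc del: fact_Suc)
      then show ?thesis
        using that by (simp add: divide_le_eq del: fact_Suc)
    qed
    then show "\<forall>\<^sub>F s in at 0. norm (exp_inv m s / s) \<le> fact (m + 2) * \<bar>s\<bar>"
      unfolding eventually_at_filter by (intro always_eventually) auto
    show "((\<lambda>s. fact (m + 2) * \<bar>s\<bar>) \<longlongrightarrow> 0) (at (0::real))"
      by (auto intro!: tendsto_eq_intros)
  qed
  then show ?thesis
    using equal by (simp add: has_field_derivative_iff exp_inv_def)
next
  case greater
  have "((\<lambda>s. exp (- 1 / s) * (1 / s) ^ m) has_real_derivative
      exp_inv (m + 2) t + (- real m) * exp_inv (m + 1) t) (at t)"
  proof -
    have "((\<lambda>s. exp (- 1 / s) * (1 / s) ^ m) has_real_derivative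
        exp (- 1 / t) * (1 / t\<^sup>2) * (1 / t) ^ m + real m * (1 / t) ^ (m - 1) * (- 1 / t\<^sup>2) * exp (- 1 / t)) (at t)"
    proof -
      have "((\<lambda>s. exp (- 1 / s)) has_real_derivative exp (- 1 / t) * (1 / t\<^sup>2)) (at t)"
        "((\<lambda>s. 1 / s) has_real_derivative - 1 / t\<^sup>2) (at t)"
        using greater by (auto intro!: derivative_eq_intros simp: power2_eq_square)
      from DERIV_mult[OF this(1) DERIV_power[OF this(2)], of m] show ?thesis
        by (simp add: algebra_simps)
    qed
    \<comment> \<open>For m = 0 the truncated exponent m - 1 is harmless, because its coefficient
      \<open>real m\<close> is 0.\<close>
    then show ?thesis
      using greater by (cases m) (simp_all add: exp_inv_def field_simps power2_eq_square)
  qed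
  then show ?thesis
    by (rule has_field_derivative_transform_within_open[of _ _ _ "{0<..}"]) (use greater in \<open>auto simp: exp_inv_def\<close>)
qed

lemma smooth_on_exp_inv: "smooth_on UNIV (exp_inv m)"
proof -
  have "Ck_on k UNIV (exp_inv m)" for k
  proof (induction k arbitrary: m)
    case 0
    show ?case
      using exp_inv_has_derivative[of m] by (auto intro!: DERIV_continuous_on)
  next
    case (Suc k)
    show ?case
      by (rule Ck_on_Suc_real[OF _ exp_inv_has_derivative])
        (intro Ck_on_add Ck_on_mult Ck_on_const Suc open_UNIV)+
  qed
  then show ?thesis
    by (simp add: smooth_on_def)
qed

lemma exists_bump:
  obtains h :: "real \<Rightarrow> real" where "smooth_on UNIV h" "\<And>t. 1 < \<bar>t\<bar> \<Longrightarrow> h t = 0" "0 < (LINT t|lborel. (h t)\<^sup>2)"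
proof
  \<comment> \<open>This is exp(-1/(1 - t^2)) on (-1,1). The argument is written with
    \<open>t \<bullet> 1\<close> so that the smoothness rule for inner products applies.\<close>
  let ?h = "\<lambda>t::real. exp_inv 0 (1 + (-1) * (t \<bullet> 1) ^ 2)"
  show sm: "smooth_on UNIV ?h"
    by (intro smooth_on_compose_real[OF _ _ smooth_on_exp_inv] smooth_on_add smooth_on_const
      smooth_on_mult smooth_on_power smooth_on_inner open_UNIV subset_UNIV)
  show zero: "?h t = 0" if "1 < \<bar>t\<bar>" for t
    using that abs_square_le_1[of t] by (auto simp: exp_inv_def not_less)
  have int: "integrable lborel (\<lambda>t. (?h t)\<^sup>2)"
    using zero smooth_on_continuous_on[OF sm]
    by (intro integrable_compact_support[of "{-1..1}"])
      (auto simp: abs_le_iff not_le intro!: continuous_on_power intro: continuous_on_subset)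
  \<comment> \<open>On [-1/2, 1/2] one has 1 - t^2 \<ge> 3/4, hence 1/(1 - t^2) \<le> 4/3; this is
    the origin of the constant exp(-4/3).\<close>
  have "0 < (LINT t|lborel. indicator {-1/2..1/2::real} t * (exp (- 4 / 3))\<^sup>2 :: real)"
    by simp
  also have "\<dots> \<le> (LINT t|lborel. (?h t)\<^sup>2)"
  proof (rule integral_mono[OF _ int])
    fix t :: real
    have "(exp (- 4 / 3))\<^sup>2 \<le> (?h t)\<^sup>2" if "t \<in> {-1/2..1/2}"
    proof (rule power_mono)
      have "t\<^sup>2 \<le> (1 / 2)\<^sup>2"
        using that by (intro abs_le_square_iff[THEN iffD1]) auto
      then have "3 / 4 \<le> 1 - t\<^sup>2"
        by (simp add: power2_eq_square)
      moreover from this have "1 / (1 - t\<^sup>2) \<le> 4 / 3"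
        by (simp add: divide_simps)
      ultimately show "exp (- 4 / 3) \<le> ?h t"
        by (simp add: exp_inv_def)
    qed simp
    then show "indicator {-1/2..1/2} t * (exp (- 4 / 3))\<^sup>2 \<le> (?h t)\<^sup>2"
      by (auto split: split_indicator)
  qed simp
  finally show "0 < (LINT t|lborel. (?h t)\<^sup>2)" .
qed

section \<open>Cones\<close>

lemma open_cone_over:
  fixes S :: "'a::euclidean_space set"
  assumes "openin (top_of_set (sphere 0 1)) S"
  shows "open (cone_over S)"
proof -
  obtain T where T: "open T" "S = sphere 0 1 \<inter> T"
    using assms by (auto simp: openin_open)
  have "continuous_on (- {0}) (sgn :: 'a \<Rightarrow> 'a)"
    unfolding sgn_div_norm by (intro continuous_intros) auto
  then have "open (sgn -` T \<inter> (- {0::'a}))"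
    using T(1) by (subst (asm) continuous_on_open_vimage) auto
  also have "sgn -` T \<inter> (- {0}) = cone_over S"
    using T(2) by (auto simp: cone_over_def norm_sgn)
  finally show ?thesis .
qed

lemma zero_notin_cone_over: "0 \<notin> cone_over S"
  by (simp add: cone_over_def)

lemma scaleR_mem_cone_over_iff: "0 < s \<Longrightarrow> s *\<^sub>R x \<in> cone_over S \<longleftrightarrow> x \<in> cone_over S"
  by (simp add: cone_over_def sgn_scaleR)

lemma mem_cone_over_sphere: "norm w = 1 \<Longrightarrow> w \<in> cone_over S \<longleftrightarrow> w \<in> S"
  by (auto simp: cone_over_def sgn_div_norm)

text \<open>Dilations map the cone onto itself and its complement, which contains the origin, onto
  itself. So they preserve both closures, whose intersection is the frontier.\<close>

lemma scaleR_mem_frontier_cone_over: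
  assumes "0 < s" "x \<in> frontier (cone_over S)"
  shows "s *\<^sub>R x \<in> frontier (cone_over S)"
proof -
  have img: "(\<lambda>y. s *\<^sub>R y) ` A = A" if A: "\<And>r y. 0 < r \<Longrightarrow> r *\<^sub>R y \<in> A \<longleftrightarrow> y \<in> A" for A :: "'a set"
  proof -
    have "y \<in> (\<lambda>y. s *\<^sub>R y) ` A" if "y \<in> A" for y
      using that A[of "1 / s" y] assms(1) by (intro image_eqI[of _ _ "(1 / s) *\<^sub>R y"]) auto
    then show ?thesis using A assms(1) by auto
  qed
  have cl: "s *\<^sub>R x \<in> closure A" if "\<And>r y. 0 < r \<Longrightarrow> r *\<^sub>R y \<in> A \<longleftrightarrow> y \<in> A" "x \<in> closure A" for A :: "'a set"
    using closure_scaleR[of s A] img[OF that(1)] that(2) by auto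
  from cl[of "cone_over S"] cl[of "- cone_over S"] assms show ?thesis
    by (simp add: frontier_closures scaleR_mem_cone_over_iff)
qed

text \<open>A cone misses the origin and so is not the whole space, even if \<open>S\<close> is the
  full sphere. Hence \<open>bdist\<close> is a true distance and not the default value of
  \<open>infdist\<close> at the empty set.\<close>

lemma frontier_cone_over_nonempty:
  assumes "S \<subseteq> sphere 0 1" "S \<noteq> {}"
  shows "frontier (cone_over S) \<noteq> {}"
proof -
  obtain w where "w \<in> S" using assms by auto
  then have "w \<in> cone_over S"
    using assms(1) mem_cone_over_sphere[of w S] by auto
  then show ?thesis
    using zero_notin_cone_over[of S] by (auto simp: frontier_eq_empty)
qed

lemma bdist_pos:
  assumes "open D" "frontier D \<noteq> {}" "x \<in> D"
  shows "0 < bdist D x"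
proof -
  have "x \<notin> frontier D"
    using assms by (simp add: frontier_def interior_open)
  then show ?thesis
    unfolding bdist_def using assms(2) infdist_pos_not_in_closed[OF frontier_closed] by auto
qed

lemma bdist_cone_over_scaleR:
  assumes "0 < s" "frontier (cone_over S) \<noteq> {}"
  shows "bdist (cone_over S) (s *\<^sub>R x) = s * bdist (cone_over S) x"
proof -
  have le: "bdist (cone_over S) (r *\<^sub>R y) \<le> r * bdist (cone_over S) y" if "0 < r" for r y
  proof -
    obtain z where z: "z \<in> frontier (cone_over S)" "infdist y (frontier (cone_over S)) = dist y z"
      using infdist_attains_inf[OF frontier_closed assms(2)] by metis
    have "infdist (r *\<^sub>R y) (frontier (cone_over S)) \<le> dist (r *\<^sub>R y) (r *\<^sub>R z)"
      using scaleR_mem_frontier_cone_over[OF that z(1)] by (rule infdist_le)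
    also have "\<dots> = r * dist y z"
      using that by (simp add: dist_norm scaleR_diff_right[symmetric])
    finally show ?thesis by (simp add: bdist_def z)
  qed
  \<comment> \<open>The opposite inequality is the same estimate for the inverse dilation.\<close>
  have "bdist (cone_over S) x \<le> (1 / s) * bdist (cone_over S) (s *\<^sub>R x)"
    using le[of "1 / s" "s *\<^sub>R x"] assms(1) by simp
  then show ?thesis
    using le[OF assms(1), of x] assms(1) by (simp add: field_simps)
qed

lemma continuous_on_inverse_bdist:
  assumes "open D" "frontier D \<noteq> {}"
  shows "continuous_on D (\<lambda>x. 1 / (bdist D x)\<^sup>2)"
proof -
  have "continuous_on D (bdist D)"
    unfolding bdist_def[abs_def] by (intro continuous_on_infdist continuous_on_id)
  then show ?thesis
    using bdist_pos[OF assms] by (intro continuous_intros) force+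
qed

section \<open>Functions homogeneous of degree zero\<close>

text \<open>The factor \<open>c\<close> is free so that the lemma can be iterated: c = 1 for a
  function of degree 0, then c = 1/s for its first derivatives, which have degree -1.\<close>

lemma partial_deriv_homogeneous:
  fixes f :: "'a::euclidean_space \<Rightarrow> real"
  assumes "f differentiable (at x)" "0 < s" "x \<noteq> 0" "\<And>y. y \<noteq> 0 \<Longrightarrow> f (s *\<^sub>R y) = c * f y"
  shows "partial_deriv b f (s *\<^sub>R x) = c / s * partial_deriv b f x"
proof -
  have "f differentiable (at ((1 / s) *\<^sub>R (s *\<^sub>R x)))"
    using assms by simp
  note has_derivative_grad[OF this]
  then have "((\<lambda>z. c * f ((1 / s) *\<^sub>R z)) has_derivative
     (\<lambda>v. c * (grad f ((1 / s) *\<^sub>R (s *\<^sub>R x)) \<bullet> ((1 / s) *\<^sub>R v)))) (at (s *\<^sub>R x))"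
    by (rule has_derivative_mult_right[OF has_derivative_compose[rotated]])
      (auto intro!: derivative_eq_intros)
  then have "(f has_derivative (\<lambda>v. c * (grad f ((1 / s) *\<^sub>R (s *\<^sub>R x)) \<bullet> ((1 / s) *\<^sub>R v)))) (at (s *\<^sub>R x))"
  proof (rule has_derivative_transform_within_open)
    show "c * f ((1 / s) *\<^sub>R z) = f z" if "z \<in> - {0}" for z
      using assms(2) assms(4)[of "(1 / s) *\<^sub>R z"] that by simp
  qed (use assms in auto)
  from partial_deriv_eqI[OF this, of b] partial_deriv_eqI[OF has_derivative_grad[OF assms(1)], of b]
  show ?thesis using assms(2) by simp
qed

lemma sphere_ext_scaleR: "0 < s \<Longrightarrow> sphere_ext \<psi> (s *\<^sub>R x) = sphere_ext \<psi> x"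
  by (simp add: sphere_ext_def sgn_scaleR)

lemma sphere_ext_sphere: "norm w = 1 \<Longrightarrow> sphere_ext \<psi> w = \<psi> w"
  by (simp add: sphere_ext_def sgn_div_norm)

context
  fixes \<psi> :: "'a::euclidean_space \<Rightarrow> real"
  assumes smooth: "smooth_on (- {0}) (sphere_ext \<psi>)"
begin

lemma partial_deriv_sphere_ext_scaleR:
  assumes "0 < s" "x \<noteq> 0"
  shows "partial_deriv b (sphere_ext \<psi>) (s *\<^sub>R x) = 1 / s * partial_deriv b (sphere_ext \<psi>) x"
  by (rule partial_deriv_homogeneous)
    (use assms smooth_on_differentiable[OF smooth] in \<open>auto simp: sphere_ext_scaleR\<close>)

lemma grad_sphere_ext_scaleR:
  assumes "0 < s" "x \<noteq> 0"
  shows "grad (sphere_ext \<psi>) (s *\<^sub>R x) = (1 / s) *\<^sub>R grad (sphere_ext \<psi>) x"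
  by (simp add: grad_def partial_deriv_sphere_ext_scaleR[OF assms] scaleR_sum_right)

lemma laplacian_sphere_ext_scaleR:
  assumes "0 < s" "x \<noteq> 0"
  shows "laplacian (sphere_ext \<psi>) (s *\<^sub>R x) = laplacian (sphere_ext \<psi>) x / s\<^sup>2"
proof -
  have "partial_deriv b (partial_deriv b (sphere_ext \<psi>)) (s *\<^sub>R x) =
      (1 / s) / s * partial_deriv b (partial_deriv b (sphere_ext \<psi>)) x" if "b \<in> Basis" for b
    by (rule partial_deriv_homogeneous)
      (use assms smooth_on_differentiable[OF smooth_on_partial_deriv[OF smooth that]] in
        \<open>auto simp: partial_deriv_sphere_ext_scaleR\<close>)
  then show ?thesis
    by (simp add: laplacian_def sum_divide_distrib power2_eq_square)
qed

text \<open>Euler's relation in degree 0: the function is constant along rays. It makes these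
  gradients orthogonal to those of radial functions.\<close>

lemma grad_sphere_ext_radial:
  assumes "x \<noteq> 0"
  shows "grad (sphere_ext \<psi>) x \<bullet> x = 0"
proof -
  have "sphere_ext \<psi> differentiable (at (1 *\<^sub>R x))"
    using smooth_on_differentiable[OF smooth] assms by simp
  from has_derivative_grad[OF this]
  have "((\<lambda>s::real. sphere_ext \<psi> (s *\<^sub>R x)) has_derivative (\<lambda>v. grad (sphere_ext \<psi>) (1 *\<^sub>R x) \<bullet> (v *\<^sub>R x))) (at 1)"
    by (rule has_derivative_compose[rotated]) (auto intro!: derivative_eq_intros)
  moreover have "((\<lambda>s::real. sphere_ext \<psi> (s *\<^sub>R x)) has_derivative (\<lambda>v. 0)) (at 1)"
    by (rule has_derivative_transform_within_open[of "\<lambda>_. sphere_ext \<psi> x" _ _ _ "{0<..}"])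
      (auto simp: sphere_ext_scaleR)
  ultimately have "(\<lambda>v. grad (sphere_ext \<psi>) (1 *\<^sub>R x) \<bullet> (v *\<^sub>R x)) = (\<lambda>v::real. 0)"
    by (rule has_derivative_unique)
  from fun_cong[OF this, of 1] show ?thesis by simp
qed

end

section \<open>Radial functions\<close>

lemma has_derivative_grad_norm_fun:
  fixes x :: "'a::euclidean_space"
  assumes "(f has_real_derivative d) (at (norm x))" "x \<noteq> 0"
  shows "((\<lambda>y. f (norm y)) has_derivative (\<lambda>v. (d *\<^sub>R sgn x) \<bullet> v)) (at x)"
proof -
  have "(norm has_derivative (\<lambda>v. v \<bullet> sgn x)) (at x)"
    by (rule has_derivative_norm[OF assms(2)])
  from has_derivative_compose[OF this assms(1)[unfolded has_field_derivative_def]]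
  show ?thesis by (simp add: inner_commute)
qed

lemma grad_ln_norm:
  assumes "x \<noteq> (0::'a::euclidean_space)"
  shows "grad (\<lambda>y. ln (norm y)) x = (1 / (norm x)\<^sup>2) *\<^sub>R x"
proof -
  have "(ln has_real_derivative 1 / norm x) (at (norm x))"
    using assms by (auto intro!: derivative_eq_intros)
  from grad_eqI[OF has_derivative_grad_norm_fun[OF this assms]] show ?thesis
    by (simp add: sgn_div_norm power2_eq_square divide_simps)
qed

text \<open>The logarithm is the function whose gradient is the field x/|x|^2. Its divergence
  (n-2)/|x|^2 turns Green's formula into the identity behind the radial Hardy inequality.\<close>

lemma laplacian_ln_norm:
  assumes "x \<noteq> (0::'a::euclidean_space)"
  shows "laplacian (\<lambda>y. ln (norm y)) x = (real DIM('a) - 2) / (norm x)\<^sup>2"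
proof -
  have "partial_deriv b (partial_deriv b (\<lambda>y. ln (norm y))) x = 1 / (x \<bullet> x) - 2 * (x \<bullet> b)\<^sup>2 / (x \<bullet> x)\<^sup>2"
    if b: "b \<in> Basis" for b
  proof -
    have "partial_deriv b (partial_deriv b (\<lambda>y. ln (norm y))) x = partial_deriv b (\<lambda>y. (y \<bullet> b) / (y \<bullet> y)) x"
    proof (rule partial_deriv_cong_open[of "- {0}"])
      fix y :: 'a assume "y \<in> - {0}"
      then show "partial_deriv b (\<lambda>y. ln (norm y)) y = (y \<bullet> b) / (y \<bullet> y)"
        using grad_inner_Basis[OF b, of "\<lambda>y. ln (norm y)" y] by (simp add: grad_ln_norm power2_norm_eq_inner)
    qed (use assms in auto)
    also have "((\<lambda>y. (y \<bullet> b) / (y \<bullet> y)) has_derivative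
        (\<lambda>v. ((v \<bullet> b) * (x \<bullet> x) - (x \<bullet> b) * (2 * (x \<bullet> v))) / ((x \<bullet> x) * (x \<bullet> x)))) (at x)"
      by (rule has_derivative_divide') (use assms in \<open>auto intro!: derivative_eq_intros simp: inner_commute\<close>)
    from partial_deriv_eqI[OF this, of b]
    have "partial_deriv b (\<lambda>y. (y \<bullet> b) / (y \<bullet> y)) x = 1 / (x \<bullet> x) - 2 * (x \<bullet> b)\<^sup>2 / (x \<bullet> x)\<^sup>2"
      using b assms by (simp add: divide_simps power2_eq_square)
    finally show ?thesis .
  qed
  then have "laplacian (\<lambda>y. ln (norm y)) x = (\<Sum>b\<in>(Basis::'a set). 1 / (x \<bullet> x) - 2 * (x \<bullet> b)\<^sup>2 / (x \<bullet> x)\<^sup>2)"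
    by (simp add: laplacian_def)
  also have "\<dots> = real DIM('a) / (x \<bullet> x) - 2 * (\<Sum>b\<in>Basis. (x \<bullet> b)\<^sup>2) / (x \<bullet> x)\<^sup>2"
    by (simp add: sum_subtractf sum_divide_distrib sum_distrib_left)
  also have "(\<Sum>b\<in>Basis. (x \<bullet> b)\<^sup>2) = x \<bullet> x"
    by (subst euclidean_inner) (simp add: power2_eq_square)
  finally show ?thesis
    using assms unfolding power2_norm_eq_inner by (simp add: divide_simps power2_eq_square)
qed

lemma has_derivative_sgn_sphere:
  assumes "norm (w::'a::euclidean_space) = 1"
  shows "(sgn has_derivative (\<lambda>v. v - (w \<bullet> v) *\<^sub>R w)) (at w)"
proof -
  have w: "w \<noteq> 0" using assms by auto
  have "((\<lambda>x. inverse (norm x) *\<^sub>R x) has_derivative (\<lambda>v. v - (w \<bullet> v) *\<^sub>R w)) (at w)"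
    using assms w has_derivative_norm[OF w]
    by (auto intro!: derivative_eq_intros simp: sgn_div_norm inner_commute)
  then show ?thesis
    by (simp add: sgn_div_norm[abs_def])
qed

section \<open>Products of radial and homogeneous functions\<close>

text \<open>Constant factors leave a Bochner integral without any integrability, so only
  \<open>F\<close> has to be integrable and nothing is asked of \<open>a\<close> and
  \<open>g\<close>.\<close>

lemma integral_polar_separated:
  fixes F :: "'a::euclidean_space \<Rightarrow> real"
  assumes "integrable lborel F"
    and "\<And>t w. norm w = 1 \<Longrightarrow> exp (real DIM('a) * t) * F (exp t *\<^sub>R w) = a t * g w"
  shows "(LINT x|lborel. F x) = (LINT t|lborel. a t) * (LINT w:sphere 0 1|surface_measure. g w)"
proof -
  have "exp (real DIM('a) * t) * (LINT w:sphere 0 1|surface_measure. F (exp t *\<^sub>R w)) =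
      a t * (LINT w:sphere 0 1|surface_measure. g w)" for t
    unfolding set_integral_mult_right[symmetric]
    by (rule set_lebesgue_integral_cong) (auto simp: assms(2))
  then show ?thesis
    by (simp add: integral_polar[OF assms(1)])
qed

text \<open>Power weight and profile are kept apart: the weight is matched against the volume factor
  \<open>exp (n * t)\<close>, and the profile is a function of t = ln |x|, where it can be
  stretched.\<close>

definition radial :: "(real \<Rightarrow> real) \<Rightarrow> real \<Rightarrow> 'a::euclidean_space \<Rightarrow> real" where
  "radial h a x = norm x powr a * h (ln (norm x))"

lemma smooth_on_radial:
  assumes "smooth_on UNIV h"
  shows "smooth_on (- {0}) (radial h a)"
  unfolding radial_def[abs_def]
  by (intro smooth_on_mult smooth_on_norm_powr smooth_on_compose_real[OF _ smooth_on_ln_norm assms]) auto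

text \<open>Since \<open>0 powr a = 0\<close> for every exponent, also a negative one, the value at
  the origin is 0 and integrands with a radial factor need no separate definition there.\<close>

lemma radial_zero [simp]: "radial h a 0 = 0"
  by (simp add: radial_def)

lemma radial_polar: "norm w = 1 \<Longrightarrow> radial h a (exp t *\<^sub>R w) = exp (a * t) * h t"
  by (simp add: radial_def exp_powr_real mult.commute)

lemma grad_radial:
  assumes "(h has_real_derivative d) (at (ln (norm x)))" "x \<noteq> 0"
  shows "grad (radial h a) x = (norm x powr (a - 1) * (a * h (ln (norm x)) + d)) *\<^sub>R sgn x"
proof -
  have "((\<lambda>r. h (ln r)) has_real_derivative d * (1 / norm x)) (at (norm x))"
    by (rule DERIV_chain2[where g=ln]) (use assms in \<open>auto intro!: derivative_eq_intros\<close>)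
  then have "((\<lambda>r. r powr a * h (ln r)) has_real_derivative
      norm x powr (a - 1) * (a * h (ln (norm x)) + d)) (at (norm x))"
    using assms(2) by (auto intro!: derivative_eq_intros simp: powr_diff field_simps)
  from grad_eqI[OF has_derivative_grad_norm_fun[OF this assms(2)]] show ?thesis
    by (simp add: radial_def[abs_def])
qed

section \<open>Compact supports in logarithmic polar coordinates\<close>

definition log_shell :: "real \<Rightarrow> 'a::euclidean_space set \<Rightarrow> 'a set" where
  "log_shell R K = (\<lambda>(t, w). exp t *\<^sub>R w) ` ({- R..R} \<times> K)"

lemma compact_log_shell: "compact K \<Longrightarrow> compact (log_shell R K)"
  unfolding log_shell_def
  by (intro compact_continuous_image compact_Times) (auto simp: case_prod_beta' intro!: continuous_intros)

lemma log_shell_subset_cone_over: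
  assumes "K \<subseteq> S" "S \<subseteq> sphere 0 1"
  shows "log_shell R K \<subseteq> cone_over S"
proof -
  have "w \<in> cone_over S" if "w \<in> K" for w
  proof -
    have "norm w = 1" using that assms by auto
    then show ?thesis using that assms mem_cone_over_sphere[of w S] by auto
  qed
  then show ?thesis
    by (auto simp: log_shell_def scaleR_mem_cone_over_iff)
qed

lemma not_in_log_shell:
  assumes "x \<notin> log_shell R K" "x \<noteq> 0" "sgn x \<in> K"
  shows "R < \<bar>ln (norm x)\<bar>"
proof (rule ccontr)
  assume "\<not> R < \<bar>ln (norm x)\<bar>"
  then have "(ln (norm x), sgn x) \<in> {- R..R} \<times> K"
    using assms(3) by auto
  then have "exp (ln (norm x)) *\<^sub>R sgn x \<in> log_shell R K"
    unfolding log_shell_def by (intro image_eqI) auto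
  moreover have "exp (ln (norm x)) *\<^sub>R sgn x = x"
    using assms(2) by (simp add: sgn_div_norm)
  ultimately show False
    using assms(1) by simp
qed

lemma has_real_derivative_partial_deriv:
  assumes "smooth_on UNIV h"
  shows "(h has_real_derivative partial_deriv 1 h t) (at t)"
  using has_derivative_grad[OF smooth_on_differentiable[OF assms], of t] grad_inner_Basis[of 1 h t]
  by (simp add: has_field_derivative_def)

definition sphere_support :: "('a::euclidean_space \<Rightarrow> real) \<Rightarrow> 'a set" where
  "sphere_support \<psi> = closure {x \<in> sphere 0 1. \<psi> x \<noteq> 0}"

lemma sphere_support_subset: "sphere_support \<psi> \<subseteq> sphere 0 1"
  unfolding sphere_support_def by (rule closure_minimal) auto

lemma compact_sphere_support: "compact (sphere_support \<psi>)"
proof -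
  have "bounded (sphere_support \<psi>)"
    by (rule bounded_subset[OF bounded_sphere sphere_support_subset])
  then show ?thesis
    by (simp add: sphere_support_def compact_eq_bounded_closed)
qed

lemma sphere_ext_eq_0:
  assumes "x \<noteq> 0" "sgn x \<notin> sphere_support \<psi>"
  shows "sphere_ext \<psi> x = 0"
proof -
  have "sgn x \<notin> {x \<in> sphere 0 1. \<psi> x \<noteq> 0}"
    using assms(2) subsetD[OF closure_subset, of "sgn x" "{x \<in> sphere 0 1. \<psi> x \<noteq> 0}"]
    unfolding sphere_support_def by argo
  then show ?thesis
    using assms(1) by (simp add: sphere_ext_def norm_sgn)
qed

lemma grad_sphere_ext_eq_0:
  assumes "x \<noteq> 0" "sgn x \<notin> sphere_support \<psi>"
  shows "grad (sphere_ext \<psi>) x = 0"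
proof -
  let ?D = "cone_over (sphere 0 1 \<inter> - sphere_support \<psi>)"
  have "open ?D"
    using compact_sphere_support[of \<psi>]
    by (intro open_cone_over) (auto simp: compact_imp_closed intro!: openin_open_Int)
  moreover have "x \<in> ?D"
    using assms by (simp add: cone_over_def norm_sgn)
  ultimately have "partial_deriv b (sphere_ext \<psi>) x = partial_deriv b (\<lambda>_. 0) x" for b
    by (rule partial_deriv_cong_open) (auto simp: cone_over_def intro!: sphere_ext_eq_0)
  then show ?thesis
    by (simp add: grad_def partial_deriv_eqI[OF has_derivative_const])
qed

text \<open>The disjunction fits all later integrands, which are a radial factor times terms in
  \<open>sphere_ext \<psi>\<close> or its gradient. At the origin, where the homogeneous extension
  is not controlled, the radial factor vanishes.\<close>

lemma radial_outside_log_shell: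
  assumes "\<And>t. R < \<bar>t\<bar> \<Longrightarrow> h t = 0" "x \<notin> log_shell R (sphere_support \<psi>)"
  shows "radial h a x = 0 \<or> sphere_ext \<psi> x = 0 \<and> grad (sphere_ext \<psi>) x = 0"
proof (cases "x = 0 \<or> sgn x \<notin> sphere_support \<psi>")
  case True
  then show ?thesis
    using sphere_ext_eq_0[of x \<psi>] grad_sphere_ext_eq_0[of x \<psi>] by (cases "x = 0") auto
next
  case False
  then have "R < \<bar>ln (norm x)\<bar>"
    using not_in_log_shell[OF assms(2)] by simp
  then show ?thesis
    using assms(1) by (simp add: radial_def)
qed

section \<open>The quadratic form on the sphere\<close>

lemma zero_outside_support:
  fixes \<phi> :: "'a::euclidean_space \<Rightarrow> real"
  assumes "x \<notin> closure {x. \<phi> x \<noteq> 0}"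
  shows "\<phi> x = 0" and "grad \<phi> x = 0"
proof -
  have *: "\<phi> y = 0" if "y \<notin> closure {x. \<phi> x \<noteq> 0}" for y
    using that subsetD[OF closure_subset, of y "{x. \<phi> x \<noteq> 0}"] by auto
  then show "\<phi> x = 0"
    using assms by blast
  show "grad \<phi> x = 0"
    using partial_deriv_zero_outside[OF closed_closure * assms] by (simp add: grad_def)
qed

lemma set_integral_test_fun:
  assumes "\<phi> \<in> test_fun D" "\<And>x. \<phi> x = 0 \<Longrightarrow> f x = 0"
  shows "(LINT x:D|lborel. f x) = (LINT x|lborel. f x)"
proof -
  have "\<phi> x = 0" if "x \<notin> D" for x
    using assms(1) that closure_subset[of "{x. \<phi> x \<noteq> 0}"] by (auto simp: test_fun_def)
  then show ?thesis
    unfolding set_lebesgue_integral_def using assms(2)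
    by (intro Bochner_Integration.integral_cong) (auto split: split_indicator)
qed

text \<open>\<open>V\<close> will be \<mu>/\<delta>^2, alone or with a spectral term l/|x|^2 added.
  Degree -2 is the degree of the squared gradient of a function of degree 0, so both parts of the
  form scale alike on spheres about the origin.\<close>

context
  fixes S :: "'a::euclidean_space set" and V :: "'a \<Rightarrow> real"
  assumes S: "openin (top_of_set (sphere 0 1)) S"
    and V_cont: "continuous_on (cone_over S) V"
    and V_scaleR: "\<And>s x. 0 < s \<Longrightarrow> V (s *\<^sub>R x) = V x / s\<^sup>2"
begin

lemma S_subset_sphere: "S \<subseteq> sphere 0 1"
  using openin_imp_subset[OF S] .

lemma test_fun_sphereD:
  assumes "\<psi> \<in> test_fun_sphere S"
  shows "smooth_on (- {0}) (sphere_ext \<psi>)" "log_shell R (sphere_support \<psi>) \<subseteq> cone_over S"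
    "log_shell R (sphere_support \<psi>) \<subseteq> - {0}"
proof -
  show "smooth_on (- {0}) (sphere_ext \<psi>)"
    using assms by (simp add: test_fun_sphere_def)
  show *: "log_shell R (sphere_support \<psi>) \<subseteq> cone_over S"
    using assms S_subset_sphere
    by (intro log_shell_subset_cone_over) (auto simp: test_fun_sphere_def sphere_support_def)
  show "log_shell R (sphere_support \<psi>) \<subseteq> - {0}"
    using * zero_notin_cone_over[of S] by auto
qed

text \<open>The tangential gradient is orthogonal to the gradient of a radial cutoff, so that the cutoff
  is not seen by the integration by parts and can be divided out.\<close>

lemma sphere_form_eq:
  assumes \<psi>: "\<psi> \<in> test_fun_sphere S"
  shows "(LINT w:S|surface_measure. \<psi> w * (- laplace_beltrami \<psi> w - V w * \<psi> w)) =
    (LINT w:sphere 0 1|surface_measure. (norm (grad (sphere_ext \<psi>) w))\<^sup>2 - V w * (\<psi> w)\<^sup>2)"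
proof -
  define \<Psi> where "\<Psi> = sphere_ext \<psi>"
  obtain h0 :: "real \<Rightarrow> real" where h0: "smooth_on UNIV h0" "\<And>t. 1 < \<bar>t\<bar> \<Longrightarrow> h0 t = 0" "0 < (LINT t|lborel. (h0 t)\<^sup>2)"
    by (rule exists_bump) blast
  \<comment> \<open>Here the cutoff enters linearly; squaring the bump makes the integral of
    \<open>h\<close> itself positive, so that it can be divided out.\<close>
  define h where "h t = (h0 t)\<^sup>2" for t
  have h: "smooth_on UNIV h" "\<And>t. 1 < \<bar>t\<bar> \<Longrightarrow> h t = 0" "0 < (LINT t|lborel. h t)"
    unfolding h_def[abs_def] using h0 by (auto intro: smooth_on_power)
  \<comment> \<open>The exponent 2 - n, together with the degree -2 of the remaining factor, cancels
    the volume factor \<open>exp (n * t)\<close> and leaves \<open>h t\<close>.\<close>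
  define \<rho> where "\<rho> = (radial h (2 - real DIM('a)) :: 'a \<Rightarrow> real)"
  define K where "K = log_shell 1 (sphere_support \<psi>)"
  have K: "compact K" "K \<subseteq> cone_over S" "K \<subseteq> - {0}"
    unfolding K_def using compact_log_shell[OF compact_sphere_support] test_fun_sphereD[OF \<psi>] by auto
  have sm: "smooth_on (- {0}) \<Psi>" "smooth_on (- {0}) \<rho>"
    unfolding \<Psi>_def \<rho>_def using test_fun_sphereD[OF \<psi>] h by (auto intro: smooth_on_radial)
  have off: "\<rho> x = 0 \<or> \<Psi> x = 0 \<and> grad \<Psi> x = 0" if "x \<notin> K" for x
    unfolding \<rho>_def \<Psi>_def using radial_outside_log_shell[OF h(2)] that by (simp add: K_def)
  note cont = continuous_on_subset[OF smooth_on_continuous_on K(3)]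
  have cV: "continuous_on K V"
    using continuous_on_subset[OF V_cont K(2)] .
  note cs = cont[OF sm(1)] cont[OF sm(2)] cont[OF smooth_on_laplacian[OF _ sm(1)]] cV
    continuous_on_subset[OF continuous_on_grad[OF sm(1)] K(3)]
  have orth: "grad (\<lambda>x. \<rho> x * \<Psi> x) x \<bullet> grad \<Psi> x = \<rho> x * (norm (grad \<Psi> x))\<^sup>2" for x
  proof (cases "x = 0")
    case True
    then have "grad (\<lambda>x. \<rho> x * \<Psi> x) x = 0"
      using partial_deriv_zero_outside[OF compact_imp_closed[OF K(1)], of "\<lambda>x. \<rho> x * \<Psi> x" x] off K(3)
      by (force simp: grad_def)
    then show ?thesis
      using True by (simp add: \<rho>_def)
  next
    case False
    have "grad \<rho> x \<bullet> grad \<Psi> x = 0"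
      using grad_radial[OF has_real_derivative_partial_deriv[OF h(1)] False]
        grad_sphere_ext_radial[OF test_fun_sphereD(1)[OF \<psi>] False]
      by (simp add: \<rho>_def \<Psi>_def sgn_div_norm inner_commute)
    then show ?thesis
      using False smooth_on_differentiable[OF sm(1)] smooth_on_differentiable[OF sm(2)]
      by (simp add: grad_mult inner_simps power2_norm_eq_inner)
  qed
  have green: "(LINT x|lborel. (\<rho> x * \<Psi> x) * laplacian \<Psi> x) = - (LINT x|lborel. \<rho> x * (norm (grad \<Psi> x))\<^sup>2)"
    using green_formula[of "- {0}" K "\<lambda>x. \<rho> x * \<Psi> x" \<Psi>] K sm off by (auto simp: orth smooth_on_mult)
  have int: "integrable lborel (\<lambda>x. (\<rho> x * \<Psi> x) * laplacian \<Psi> x)" "integrable lborel (\<lambda>x. \<rho> x * (norm (grad \<Psi> x))\<^sup>2)"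
    "integrable lborel (\<lambda>x. \<rho> x * (V x * (\<Psi> x)\<^sup>2))"
    by (rule integrable_compact_support[OF K(1)]; use off in \<open>force intro!: continuous_intros cs\<close>)+
  define F1 where "F1 x = \<rho> x * (\<Psi> x * (- laplacian \<Psi> x - V x * \<Psi> x))" for x
  define F2 where "F2 x = \<rho> x * ((norm (grad \<Psi> x))\<^sup>2 - V x * (\<Psi> x)\<^sup>2)" for x
  have F1: "F1 = (\<lambda>x. - ((\<rho> x * \<Psi> x) * laplacian \<Psi> x) - \<rho> x * (V x * (\<Psi> x)\<^sup>2))"
    and F2: "F2 = (\<lambda>x. \<rho> x * (norm (grad \<Psi> x))\<^sup>2 - \<rho> x * (V x * (\<Psi> x)\<^sup>2))"
    by (auto simp: F1_def F2_def fun_eq_iff algebra_simps power2_eq_square)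
  have iF: "integrable lborel F1" "integrable lborel F2"
    unfolding F1 F2 using int by auto
  have ex: "exp (real DIM('a) * t) * (exp ((2 - real DIM('a)) * t) * y) = (exp t)\<^sup>2 * y" for t y :: real
  proof -
    have "real DIM('a) * t + (2 - real DIM('a)) * t = 2 * t"
      by (simp add: algebra_simps)
    then show ?thesis
      by (simp only: mult.assoc[symmetric] exp_add[symmetric] exp_double[symmetric])
  qed
  have w0: "w \<noteq> 0" if "norm w = 1" for w :: 'a
    using that by auto
  note hom = laplacian_sphere_ext_scaleR[OF test_fun_sphereD(1)[OF \<psi>]] V_scaleR
    grad_sphere_ext_scaleR[OF test_fun_sphereD(1)[OF \<psi>]] sphere_ext_scaleR sphere_ext_sphere
  have "(LINT x|lborel. F1 x) = (LINT t|lborel. h t) *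
      (LINT w:sphere 0 1|surface_measure. \<psi> w * (- laplace_beltrami \<psi> w - V w * \<psi> w))"
    by (rule integral_polar_separated[OF iF(1)])
      (simp add: F1_def \<rho>_def \<Psi>_def radial_polar hom w0 laplace_beltrami_def ex mult.assoc, simp add: field_simps)
  moreover have "(LINT x|lborel. F2 x) = (LINT t|lborel. h t) *
      (LINT w:sphere 0 1|surface_measure. (norm (grad \<Psi> w))\<^sup>2 - V w * (\<psi> w)\<^sup>2)"
    by (rule integral_polar_separated[OF iF(2)])
      (simp add: F2_def \<rho>_def \<Psi>_def radial_polar hom w0 ex mult.assoc power_divide, simp add: field_simps)
  moreover have "(LINT x|lborel. F1 x) = (LINT x|lborel. F2 x)"
    unfolding F1 F2 using int green by simp
  moreover have "(LINT w:S|surface_measure. \<psi> w * (- laplace_beltrami \<psi> w - V w * \<psi> w)) =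
    (LINT w:sphere 0 1|surface_measure. \<psi> w * (- laplace_beltrami \<psi> w - V w * \<psi> w))"
    unfolding set_lebesgue_integral_def
  proof (rule Bochner_Integration.integral_cong[OF refl])
    fix w :: 'a
    have "\<psi> w = 0" if "w \<in> sphere 0 1" "w \<notin> S"
      using \<psi> that closure_subset[of "{x \<in> sphere 0 1. \<psi> x \<noteq> 0}"] by (auto simp: test_fun_sphere_def)
    then show "indicat_real S w *\<^sub>R (\<psi> w * (- laplace_beltrami \<psi> w - V w * \<psi> w)) =
      indicat_real (sphere 0 1) w *\<^sub>R (\<psi> w * (- laplace_beltrami \<psi> w - V w * \<psi> w))"
      using S_subset_sphere by (auto split: split_indicator)
  qed
  ultimately show ?thesis
    using h(3) by (simp add: \<Psi>_def)
qed

text \<open>Testing with $|x|^{(2-n)/2}\, h(\ln |x|)\, \psi(x/|x|)$.\<close>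

lemma cutoff_form_nonneg:
  fixes h :: "real \<Rightarrow> real"
  assumes \<psi>: "\<psi> \<in> test_fun_sphere S"
    and pos: "\<And>\<phi>. \<phi> \<in> test_fun (cone_over S) \<Longrightarrow> 0 \<le> (LINT x|lborel. (norm (grad \<phi> x))\<^sup>2 - V x * (\<phi> x)\<^sup>2)"
    and h: "smooth_on UNIV h" "\<And>t. R < \<bar>t\<bar> \<Longrightarrow> h t = 0"
  shows "0 \<le> (LINT t|lborel. (partial_deriv 1 h t)\<^sup>2) * (LINT w:sphere 0 1|surface_measure. (\<psi> w)\<^sup>2) +
    (LINT t|lborel. (h t)\<^sup>2) * (LINT w:sphere 0 1|surface_measure.
      (norm (grad (sphere_ext \<psi>) w))\<^sup>2 - (V w - (2 - real DIM('a))\<^sup>2 / 4) * (\<psi> w)\<^sup>2)"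
proof -
  define \<Psi> where "\<Psi> = sphere_ext \<psi>"
  \<comment> \<open>With this \<open>a\<close> one has n + 2a - 2 = 0, so all exponentials cancel in
    polar coordinates.\<close>
  define a where "a = (2 - real DIM('a)) / 2"
  define h' where "h' = partial_deriv 1 h"
  define \<rho> where "\<rho> = (radial h a :: 'a \<Rightarrow> real)"
  define K where "K = log_shell R (sphere_support \<psi>)"
  have dh: "(h has_real_derivative h' t) (at t)" for t
    unfolding h'_def by (rule has_real_derivative_partial_deriv[OF h(1)])
  have h': "smooth_on UNIV h'" "\<And>t. R < \<bar>t\<bar> \<Longrightarrow> h' t = 0"
  proof -
    show "smooth_on UNIV h'"
      unfolding h'_def by (intro smooth_on_partial_deriv h) auto
    show "h' t = 0" if "R < \<bar>t\<bar>" for t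
      unfolding h'_def by (rule partial_deriv_zero_outside[of "{-R..R}"]) (use h(2) that in \<open>auto simp: abs_less_iff not_le\<close>)
  qed
  have K: "compact K" "K \<subseteq> cone_over S" "K \<subseteq> - {0}"
    unfolding K_def using compact_log_shell[OF compact_sphere_support] test_fun_sphereD[OF \<psi>] by auto
  have sm: "smooth_on (- {0}) \<Psi>" "smooth_on (- {0}) \<rho>"
    unfolding \<Psi>_def \<rho>_def using test_fun_sphereD[OF \<psi>] h by (auto intro: smooth_on_radial)
  have off: "radial g c x = 0 \<or> \<Psi> x = 0 \<and> grad \<Psi> x = 0" if "x \<notin> K" "\<And>t. R < \<bar>t\<bar> \<Longrightarrow> g t = 0" for x g c
    unfolding \<Psi>_def using radial_outside_log_shell[of R g, OF that(2)] that(1) by (simp add: K_def)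
  have cV: "continuous_on K V"
    using continuous_on_subset[OF V_cont K(2)] .
  note cont = continuous_on_subset[OF smooth_on_continuous_on K(3)]
  note cs = cont[OF sm(1)] cont[OF smooth_on_radial] cV
    continuous_on_subset[OF continuous_on_grad[OF sm(1)] K(3)]
    smooth_on_power smooth_on_mult smooth_on_const h h'
  define \<phi> where "\<phi> x = \<rho> x * \<Psi> x" for x
  have \<phi>0: "\<phi> x = 0" if "x \<notin> K" for x
    unfolding \<phi>_def \<rho>_def using off[OF that h(2)] by auto
  have "smooth_on UNIV \<phi>"
    by (rule smooth_on_zero_extension[of "- {0}", OF _ K(1,3)])
      (use sm \<phi>0 in \<open>auto simp: \<phi>_def[abs_def] intro!: smooth_on_mult\<close>)
  moreover have supp: "closure {x. \<phi> x \<noteq> 0} \<subseteq> K"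
    by (rule closure_minimal) (use \<phi>0 compact_imp_closed[OF K(1)] in auto)
  moreover have "compact (closure {x. \<phi> x \<noteq> 0})"
    using supp K(1) by (meson bounded_subset closed_closure compact_eq_bounded_closed)
  ultimately have "\<phi> \<in> test_fun (cone_over S)"
    using K(2) by (auto simp: test_fun_def)
  note nonneg = pos[OF this]
  \<comment> \<open>The cross terms between \<open>grad \<rho>\<close> and
    \<open>grad \<Psi>\<close> vanish by orthogonality, and |grad \<rho>|^2 contains (a h + h')^2 =
    a^2 h^2 + h'^2 + 2 a h h'. The a^2 part joins the potential in \<open>F2\<close>; the other two
    give \<open>F3\<close> and \<open>F4\<close>.\<close>
  define F2 where "F2 x = radial (\<lambda>t. (h t)\<^sup>2) (2 * a) x * ((norm (grad \<Psi> x))\<^sup>2 - (V x - a\<^sup>2 / (norm x)\<^sup>2) * (\<Psi> x)\<^sup>2)" for x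
  define F3 where "F3 x = radial (\<lambda>t. (h' t)\<^sup>2) (2 * a - 2) x * (\<Psi> x)\<^sup>2" for x
  define F4 where "F4 x = radial (\<lambda>t. h t * h' t) (2 * a - 2) x * (\<Psi> x)\<^sup>2" for x
  have split: "(norm (grad \<phi> x))\<^sup>2 - V x * (\<phi> x)\<^sup>2 = F2 x + F3 x + 2 * a * F4 x" for x
  proof (cases "x = 0")
    case True
    then have "grad \<phi> x = 0"
      using partial_deriv_zero_outside[OF compact_imp_closed[OF K(1)], of \<phi> x] \<phi>0 K(3)
      by (force simp: grad_def)
    then show ?thesis
      using True by (simp add: \<phi>_def \<rho>_def F2_def F3_def F4_def)
  next
    case False
    define r where "r = norm x"
    have r: "0 < r" using False by (simp add: r_def)
    have g\<rho>: "grad \<rho> x = (r powr (a - 1) * (a * h (ln r) + h' (ln r))) *\<^sub>R sgn x"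
      unfolding \<rho>_def r_def by (rule grad_radial[OF dh False])
    have n\<rho>: "grad \<rho> x \<bullet> grad \<rho> x = r powr (2 * a - 2) * (a * h (ln r) + h' (ln r))\<^sup>2"
    proof -
      have "r powr (a - 1) * r powr (a - 1) = r powr (2 * a - 2)"
        by (simp add: powr_add[symmetric])
      then show ?thesis
        unfolding g\<rho> using False by (simp add: dot_square_norm norm_sgn power2_eq_square mult_ac)
    qed
    have orth: "grad \<rho> x \<bullet> grad \<Psi> x = 0"
      using grad_sphere_ext_radial[OF test_fun_sphereD(1)[OF \<psi>] False]
      by (simp add: g\<rho> \<Psi>_def sgn_div_norm inner_commute)
    have "grad \<phi> x = \<rho> x *\<^sub>R grad \<Psi> x + \<Psi> x *\<^sub>R grad \<rho> x"
      unfolding \<phi>_def[abs_def] using False smooth_on_differentiable[OF sm(1)] smooth_on_differentiable[OF sm(2)]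
      by (intro grad_mult) auto
    then have "(norm (grad \<phi> x))\<^sup>2 = (\<rho> x)\<^sup>2 * (norm (grad \<Psi> x))\<^sup>2 + (\<Psi> x)\<^sup>2 * (grad \<rho> x \<bullet> grad \<rho> x)"
      using orth unfolding power2_norm_eq_inner by (simp add: inner_simps inner_commute power2_eq_square)
    moreover have "(\<rho> x)\<^sup>2 = r powr (2 * a) * (h (ln r))\<^sup>2"
      by (simp add: \<rho>_def radial_def r_def power_mult_distrib power2_eq_square powr_add[symmetric])
    moreover have "r powr (2 * a) = r powr (2 * a - 2) * r\<^sup>2"
      using r by (simp add: powr_diff powr_numeral)
    ultimately show ?thesis
      using r unfolding F2_def F3_def F4_def n\<rho> radial_def r_def[symmetric] \<phi>_def power_mult_distrib
      by (simp add: field_simps power2_eq_square)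
  qed
  have int: "integrable lborel F2" "integrable lborel F3" "integrable lborel F4"
  proof -
    show "integrable lborel F2"
    proof (rule integrable_compact_support[OF K(1)])
      show "continuous_on K F2"
        unfolding F2_def[abs_def] using K(3) by (intro continuous_intros cs open_UNIV) auto
      show "F2 x = 0" if "x \<notin> K" for x
        using off[OF that, of "\<lambda>t. (h t)\<^sup>2" "2 * a"] h by (auto simp: F2_def)
    qed
    show "integrable lborel F3"
    proof (rule integrable_compact_support[OF K(1)])
      show "continuous_on K F3"
        unfolding F3_def[abs_def] by (intro continuous_intros cs open_UNIV)
      show "F3 x = 0" if "x \<notin> K" for x
        using off[OF that, of "\<lambda>t. (h' t)\<^sup>2"] h' by (auto simp: F3_def)
    qed
    show "integrable lborel F4"
    proof (rule integrable_compact_support[OF K(1)])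
      show "continuous_on K F4"
        unfolding F4_def[abs_def] by (intro continuous_intros cs open_UNIV)
      show "F4 x = 0" if "x \<notin> K" for x
        using off[OF that, of "\<lambda>t. h t * h' t"] h by (auto simp: F4_def)
    qed
  qed
  have ex: "exp (real DIM('a) * t) * (exp (2 * a * t) * y) = (exp t)\<^sup>2 * y"
    "exp (real DIM('a) * t) * (exp ((2 * a - 2) * t) * y) = y" for t y :: real
  proof -
    have "real DIM('a) * t + 2 * a * t = 2 * t" "real DIM('a) * t + (2 * a - 2) * t = 0"
      by (simp_all add: a_def field_simps)
    then show "exp (real DIM('a) * t) * (exp (2 * a * t) * y) = (exp t)\<^sup>2 * y"
      "exp (real DIM('a) * t) * (exp ((2 * a - 2) * t) * y) = y"
      by (simp_all only: mult.assoc[symmetric] exp_add[symmetric] exp_double[symmetric] exp_zero mult_1)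
  qed
  have w0: "w \<noteq> 0" if "norm w = 1" for w :: 'a
    using that by auto
  note hom = V_scaleR grad_sphere_ext_scaleR[OF test_fun_sphereD(1)[OF \<psi>]] sphere_ext_scaleR sphere_ext_sphere
  have "(LINT x|lborel. F2 x) = (LINT t|lborel. (h t)\<^sup>2) *
      (LINT w:sphere 0 1|surface_measure. (norm (grad \<Psi> w))\<^sup>2 - (V w - a\<^sup>2) * (\<psi> w)\<^sup>2)"
  proof (rule integral_polar_separated[OF int(1)])
    fix t :: real and w :: 'a
    assume w: "norm w = 1"
    let ?y = "(h t)\<^sup>2 * ((norm (grad \<Psi> w))\<^sup>2 - (V w - a\<^sup>2) * (\<psi> w)\<^sup>2)"
    have "F2 (exp t *\<^sub>R w) = exp (2 * a * t) * (?y / (exp t)\<^sup>2)"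
      using w by (simp add: F2_def \<Psi>_def radial_polar hom w0 power_divide) (simp add: field_simps)
    then show "exp (real DIM('a) * t) * F2 (exp t *\<^sub>R w) = ?y"
      by (simp only: ex) simp
  qed
  moreover have "(LINT x|lborel. F3 x) = (LINT t|lborel. (h' t)\<^sup>2) * (LINT w:sphere 0 1|surface_measure. (\<psi> w)\<^sup>2)"
    by (rule integral_polar_separated[OF int(2)])
      (simp add: F3_def \<Psi>_def radial_polar hom w0 ex mult.assoc)
  moreover have "(LINT x|lborel. F4 x) = (LINT t|lborel. h t * h' t) * (LINT w:sphere 0 1|surface_measure. (\<psi> w)\<^sup>2)"
    by (rule integral_polar_separated[OF int(3)])
      (simp add: F4_def \<Psi>_def radial_polar hom w0 ex mult.assoc)
  \<comment> \<open>2 h h' is the derivative of h^2, which has compact support.\<close>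
  moreover have "(LINT t|lborel. h t * h' t) = 0"
  proof -
    have "partial_deriv 1 (\<lambda>t. h t * h t) t = 2 * (h t * h' t)" for t
      using partial_deriv_mult[of h t h 1] smooth_on_differentiable[OF h(1)] by (simp add: h'_def)
    moreover have "(LINT t|lborel. partial_deriv 1 (\<lambda>t. h t * h t) t) = 0"
      by (rule integral_partial_deriv_eq_0[of _ "{-R..R}"])
        (use h(2) in \<open>auto simp: abs_less_iff not_le intro!: smooth_on_mult h(1)\<close>)
    ultimately show ?thesis by simp
  qed
  moreover have "a\<^sup>2 = (2 - real DIM('a))\<^sup>2 / 4"
    by (simp add: a_def power_divide)
  ultimately show ?thesis
    using nonneg int unfolding split by (simp add: h'_def \<Psi>_def add.commute)
qed

text \<open>Stretched profiles h(e t) make the h'^2 term negligible against the h^2 term, so in the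
  limit the coefficient of the latter cannot be negative.\<close>

lemma sphere_form_nonneg:
  assumes \<psi>: "\<psi> \<in> test_fun_sphere S"
    and pos: "\<And>\<phi>. \<phi> \<in> test_fun (cone_over S) \<Longrightarrow> 0 \<le> (LINT x|lborel. (norm (grad \<phi> x))\<^sup>2 - V x * (\<phi> x)\<^sup>2)"
  shows "0 \<le> (LINT w:sphere 0 1|surface_measure.
      (norm (grad (sphere_ext \<psi>) w))\<^sup>2 - (V w - (2 - real DIM('a))\<^sup>2 / 4) * (\<psi> w)\<^sup>2)" (is "0 \<le> ?q")
proof -
  obtain h :: "real \<Rightarrow> real" where h: "smooth_on UNIV h" "\<And>t. 1 < \<bar>t\<bar> \<Longrightarrow> h t = 0" "0 < (LINT t|lborel. (h t)\<^sup>2)"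
    by (rule exists_bump) blast
  let ?P = "LINT w:sphere 0 1|surface_measure. (\<psi> w)\<^sup>2"
  let ?D = "LINT t|lborel. (partial_deriv 1 h t)\<^sup>2"
  let ?H = "LINT t|lborel. (h t)\<^sup>2"
  have step: "0 \<le> e\<^sup>2 * (?D * ?P) + ?H * ?q" if e: "0 < e" for e
  proof -
    have lin: "smooth_on UNIV (\<lambda>t::real. e * (t \<bullet> 1))"
      by (intro smooth_on_mult smooth_on_const smooth_on_inner) auto
    have sm: "smooth_on UNIV (\<lambda>t. h (e * t))"
      using smooth_on_compose_real[OF open_UNIV lin h(1)] by simp
    have pd: "partial_deriv 1 (\<lambda>t. h (e * t)) t = e * partial_deriv 1 h (e * t)" for t
    proof -
      have "((\<lambda>t. h (e * t)) has_real_derivative partial_deriv 1 h (e * t) * e) (at t)"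
        by (rule DERIV_chain2[where f=h, OF has_real_derivative_partial_deriv[OF h(1)]])
          (auto intro!: derivative_eq_intros)
      from partial_deriv_eqI[OF this[unfolded has_field_derivative_def], of 1] show ?thesis
        by simp
    qed
    have scale: "(LINT t|lborel. f t) = e * (LINT t|lborel. f (e * t))" for f :: "real \<Rightarrow> real"
      using lborel_integral_real_affine[of e f 0] e by simp
    have "0 \<le> (LINT t|lborel. (partial_deriv 1 (\<lambda>t. h (e * t)) t)\<^sup>2) * ?P + (LINT t|lborel. (h (e * t))\<^sup>2) * ?q"
      by (rule cutoff_form_nonneg[OF \<psi> pos sm, of "1 / e"])
        (use h(2) e in \<open>auto simp: abs_mult divide_less_eq mult.commute\<close>)
    also have "(LINT t|lborel. (partial_deriv 1 (\<lambda>t. h (e * t)) t)\<^sup>2) = e\<^sup>2 * (LINT t|lborel. (partial_deriv 1 h (e * t))\<^sup>2)"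
      by (simp add: pd power_mult_distrib)
    \<comment> \<open>Undoing the substitution costs 1/e in both integrals over t, which the factor
      e removes. The e^2 from differentiating h(e t) remains in the first term only.\<close>
    finally have "0 \<le> e * (e\<^sup>2 * (LINT t|lborel. (partial_deriv 1 h (e * t))\<^sup>2) * ?P + (LINT t|lborel. (h (e * t))\<^sup>2) * ?q)"
      using e by simp
    then show ?thesis
      by (simp add: scale[of "\<lambda>t. (h t)\<^sup>2"] scale[of "\<lambda>t. (partial_deriv 1 h t)\<^sup>2"] algebra_simps)
  qed
  have "((\<lambda>e. e\<^sup>2 * (?D * ?P) + ?H * ?q) \<longlongrightarrow> 0\<^sup>2 * (?D * ?P) + ?H * ?q) (at_right 0)"
    by (intro tendsto_intros)
  moreover have "\<forall>\<^sub>F e in at_right 0. 0 \<le> e\<^sup>2 * (?D * ?P) + ?H * ?q"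
    using step by (auto simp: eventually_at_right_less intro: eventually_mono[OF eventually_at_right_less])
  ultimately have "0 \<le> 0\<^sup>2 * (?D * ?P) + ?H * ?q"
    by (intro tendsto_lowerbound) auto
  then show ?thesis
    using h(3) by (simp add: zero_le_mult_iff)
qed

section \<open>From the sphere to the cone\<close>

text \<open>Dilation by \<open>s\<close> carries the support of the slice into the support of
  \<phi>, which lies inside the cone.\<close>

lemma test_fun_slice:
  assumes \<phi>: "\<phi> \<in> test_fun (cone_over S)" and "0 < s"
  shows "(\<lambda>w. \<phi> (s *\<^sub>R w)) \<in> test_fun_sphere S"
proof -
  have "smooth_on (- {0}) (sphere_ext (\<lambda>w. \<phi> (s *\<^sub>R w)))"
    unfolding sphere_ext_def[abs_def] using \<phi> by (intro smooth_on_sgn_compose) (simp add: test_fun_def)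
  moreover have "w \<in> S" if w: "w \<in> closure {w \<in> sphere 0 1. \<phi> (s *\<^sub>R w) \<noteq> 0}" for w
  proof -
    have "norm w = 1"
      using w sphere_support_subset[of "\<lambda>w. \<phi> (s *\<^sub>R w)"] by (auto simp: sphere_support_def)
    have "s *\<^sub>R w \<in> closure ((\<lambda>x. s *\<^sub>R x) ` {w \<in> sphere 0 1. \<phi> (s *\<^sub>R w) \<noteq> 0})"
      using w closure_scaleR[of s "{w \<in> sphere 0 1. \<phi> (s *\<^sub>R w) \<noteq> 0}"] by blast
    also have "\<dots> \<subseteq> closure {x. \<phi> x \<noteq> 0}"
      by (rule closure_mono) auto
    also have "\<dots> \<subseteq> cone_over S"
      using \<phi> by (simp add: test_fun_def)
    finally show ?thesis
      using \<open>norm w = 1\<close> \<open>0 < s\<close> by (simp add: scaleR_mem_cone_over_iff mem_cone_over_sphere)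
  qed
  ultimately show ?thesis
    by (auto simp: test_fun_sphere_def)
qed

text \<open>Subtracting the squared radial derivative leaves the tangential energy. On the sphere of
  radius exp(t) it is exp(-2t) times that of the slice, and the potential scales in the same way, so
  the assumed inequality is applied slice by slice and integrated over t.\<close>

lemma cone_form_nonneg:
  assumes \<phi>: "\<phi> \<in> test_fun (cone_over S)"
    and pos: "\<And>\<psi>. \<psi> \<in> test_fun_sphere S \<Longrightarrow>
      0 \<le> (LINT w:sphere 0 1|surface_measure. (norm (grad (sphere_ext \<psi>) w))\<^sup>2 - V w * (\<psi> w)\<^sup>2)"
  shows "0 \<le> (LINT x|lborel. (norm (grad \<phi> x))\<^sup>2 - (sgn x \<bullet> grad \<phi> x)\<^sup>2 - V x * (\<phi> x)\<^sup>2)"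
proof -
  define K where "K = closure {x. \<phi> x \<noteq> 0}"
  define F where "F x = (norm (grad \<phi> x))\<^sup>2 - (sgn x \<bullet> grad \<phi> x)\<^sup>2 - V x * (\<phi> x)\<^sup>2" for x
  have sm: "smooth_on UNIV \<phi>" and K: "compact K" "K \<subseteq> cone_over S"
    using \<phi> by (auto simp: test_fun_def K_def)
  have K0: "0 \<notin> K"
    using K(2) zero_notin_cone_over by auto
  have \<phi>0: "\<phi> x = 0" if "x \<notin> K" for x
    using zero_outside_support(1)[of x \<phi>] that by (simp add: K_def)
  have "integrable lborel F"
  proof (rule integrable_compact_support[OF K(1)])
    show "continuous_on K F"
      unfolding F_def[abs_def] sgn_div_norm using K0
      by (intro continuous_intros continuous_on_subset[OF V_cont K(2)]
          continuous_on_subset[OF continuous_on_grad[OF sm]] continuous_on_subset[OF smooth_on_continuous_on[OF sm]]) auto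
    show "F x = 0" if "x \<notin> K" for x
      using partial_deriv_zero_outside[OF compact_imp_closed[OF K(1)] \<phi>0 that] \<phi>0[OF that] by (simp add: F_def grad_def)
  qed
  then have "(LINT x|lborel. F x) =
      (LINT t|lborel. exp (real DIM('a) * t) * (LINT w:sphere 0 1|surface_measure. F (exp t *\<^sub>R w)))"
    by (rule integral_polar)
  also have "0 \<le> \<dots>"
  proof (intro Bochner_Integration.integral_nonneg mult_nonneg_nonneg)
    fix t :: real
    define \<psi> where "\<psi> w = \<phi> (exp t *\<^sub>R w)" for w
    have \<psi>: "\<psi> \<in> test_fun_sphere S"
      unfolding \<psi>_def[abs_def] by (rule test_fun_slice[OF \<phi>]) simp
    \<comment> \<open>The derivative of \<open>sgn\<close> at \<open>w\<close> is the projection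
      orthogonal to \<open>w\<close>, so the gradient of the slice is exp(t) times the tangential
      part of \<open>grad \<phi>\<close>.\<close>
    have eq: "F (exp t *\<^sub>R w) = (1 / (exp t)\<^sup>2) * ((norm (grad (sphere_ext \<psi>) w))\<^sup>2 - V w * (\<psi> w)\<^sup>2)"
      if w: "norm w = 1" for w
    proof -
      define g where "g = grad \<phi> (exp t *\<^sub>R w)"
      have sg: "sgn w = w" using w by (simp add: sgn_div_norm)
      have "\<phi> differentiable (at (exp t *\<^sub>R sgn w))"
        using smooth_on_differentiable[OF sm] by simp
      note d\<phi> = has_derivative_grad[OF this]
      have "((\<lambda>x. \<phi> (exp t *\<^sub>R sgn x)) has_derivative
          (\<lambda>v. grad \<phi> (exp t *\<^sub>R sgn w) \<bullet> (exp t *\<^sub>R (v - (w \<bullet> v) *\<^sub>R w)))) (at w)"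
        by (rule has_derivative_compose[OF has_derivative_scaleR_right[OF has_derivative_sgn_sphere[OF w]] d\<phi>])
      then have "(sphere_ext \<psi> has_derivative (\<lambda>v. (exp t *\<^sub>R (g - (w \<bullet> g) *\<^sub>R w)) \<bullet> v)) (at w)"
        by (simp add: sphere_ext_def[abs_def] \<psi>_def sg g_def inner_simps inner_commute algebra_simps)
      then have "grad (sphere_ext \<psi>) w = exp t *\<^sub>R (g - (w \<bullet> g) *\<^sub>R w)"
        by (rule grad_eqI)
      moreover have "(norm (g - (w \<bullet> g) *\<^sub>R w))\<^sup>2 = (norm g)\<^sup>2 - (w \<bullet> g)\<^sup>2"
      proof -
        have "w \<bullet> w = 1" using w by (simp add: dot_square_norm)
        then show ?thesis
          unfolding power2_norm_eq_inner by (simp add: inner_simps inner_commute power2_eq_square)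
      qed
      ultimately have "(norm (grad (sphere_ext \<psi>) w))\<^sup>2 = (exp t)\<^sup>2 * ((norm g)\<^sup>2 - (w \<bullet> g)\<^sup>2)"
        by (simp add: power_mult_distrib)
      then show ?thesis
        by (simp add: F_def g_def[symmetric] \<psi>_def[symmetric] sgn_scaleR sg V_scaleR field_simps)
    qed
    have "(LINT w:sphere 0 1|surface_measure. F (exp t *\<^sub>R w)) =
      (1 / (exp t)\<^sup>2) * (LINT w:sphere 0 1|surface_measure. (norm (grad (sphere_ext \<psi>) w))\<^sup>2 - V w * (\<psi> w)\<^sup>2)"
      unfolding set_integral_mult_right[symmetric]
      by (rule set_lebesgue_integral_cong) (auto simp: eq)
    also have "0 \<le> \<dots>"
      using pos[OF \<psi>] by simp
    finally show "0 \<le> (LINT w:sphere 0 1|surface_measure. F (exp t *\<^sub>R w))" .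
  qed simp
  finally show ?thesis by (simp add: F_def)
qed

end

section \<open>The radial Hardy inequality\<close>

lemma integrable_radial_grad:
  fixes \<phi> :: "'a::euclidean_space \<Rightarrow> real"
  assumes \<phi>: "\<phi> \<in> test_fun (- {0})"
  shows "integrable lborel (\<lambda>x. (sgn x \<bullet> grad \<phi> x)\<^sup>2)"
    and "integrable lborel (\<lambda>x. \<phi> x * (sgn x \<bullet> grad \<phi> x) / norm x)"
    and "integrable lborel (\<lambda>x. (\<phi> x)\<^sup>2 / (norm x)\<^sup>2)"
proof -
  define K where "K = closure {x. \<phi> x \<noteq> 0}"
  have sm: "smooth_on UNIV \<phi>" and K: "compact K" "K \<subseteq> - {0}"
    using \<phi> by (auto simp: test_fun_def K_def)
  have K0: "0 \<notin> K" using K(2) by auto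
  have \<phi>0: "\<phi> x = 0" if "x \<notin> K" for x
    using zero_outside_support(1)[of x \<phi>] that by (simp add: K_def)
  have d\<phi>0: "grad \<phi> x = 0" if "x \<notin> K" for x
    using zero_outside_support(2)[of x \<phi>] that by (simp add: K_def)
  note cs = continuous_on_subset[OF continuous_on_grad[OF sm], of K] continuous_on_subset[OF smooth_on_continuous_on[OF sm], of K]
  show "integrable lborel (\<lambda>x. (sgn x \<bullet> grad \<phi> x)\<^sup>2)"
    unfolding sgn_div_norm using K0
    by (intro integrable_compact_support[OF K(1)] continuous_intros cs) (auto simp: \<phi>0 d\<phi>0)
  show "integrable lborel (\<lambda>x. \<phi> x * (sgn x \<bullet> grad \<phi> x) / norm x)"
    unfolding sgn_div_norm using K0
    by (intro integrable_compact_support[OF K(1)] continuous_intros cs) (auto simp: \<phi>0 d\<phi>0)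
  show "integrable lborel (\<lambda>x. (\<phi> x)\<^sup>2 / (norm x)\<^sup>2)"
    using K0
    by (intro integrable_compact_support[OF K(1)] continuous_intros cs) (auto simp: \<phi>0 d\<phi>0)
qed

text \<open>Instead of treating each ray separately, Green's formula for \<phi>^2 and ln |x| gives
  (n-2) \<integral> \<phi>^2/|x|^2 = -2 \<integral> \<phi> \<phi>'/|x| in the whole space, with
  \<phi>' the radial derivative. Expanding a square then gives the inequality.\<close>

lemma radial_hardy:
  fixes \<phi> :: "'a::euclidean_space \<Rightarrow> real"
  assumes \<phi>: "\<phi> \<in> test_fun (- {0})"
  shows "(2 - real DIM('a))\<^sup>2 / 4 * (LINT x|lborel. (\<phi> x)\<^sup>2 / (norm x)\<^sup>2) \<le> (LINT x|lborel. (sgn x \<bullet> grad \<phi> x)\<^sup>2)"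
proof -
  define n where "n = real DIM('a)"
  define K where "K = closure {x. \<phi> x \<noteq> 0}"
  have sm: "smooth_on UNIV \<phi>" and K: "compact K" "K \<subseteq> - {0}"
    using \<phi> by (auto simp: test_fun_def K_def)
  have K0: "0 \<notin> K" using K(2) by auto
  have \<phi>0: "\<phi> x = 0" if "x \<notin> K" for x
    using zero_outside_support(1)[of x \<phi>] that by (simp add: K_def)
  define X where "X x = \<phi> x * (sgn x \<bullet> grad \<phi> x) / norm x" for x
  have int: "integrable lborel (\<lambda>x. (\<phi> x)\<^sup>2 / (norm x)\<^sup>2)" "integrable lborel (\<lambda>x. (sgn x \<bullet> grad \<phi> x)\<^sup>2)"
      "integrable lborel X"
    unfolding X_def[abs_def] using integrable_radial_grad[OF \<phi>] by auto
  have "(LINT x|lborel. (\<phi> x * \<phi> x) * laplacian (\<lambda>y. ln (norm y)) x) =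
      - (LINT x|lborel. grad (\<lambda>x. \<phi> x * \<phi> x) x \<bullet> grad (\<lambda>y. ln (norm y)) x)"
    using sm smooth_on_subset
    by (intro green_formula[of "- {0}" K] K smooth_on_ln_norm smooth_on_mult) (auto simp: \<phi>0)
  also have "(\<lambda>x. (\<phi> x * \<phi> x) * laplacian (\<lambda>y. ln (norm y)) x) = (\<lambda>x. (n - 2) * ((\<phi> x)\<^sup>2 / (norm x)\<^sup>2))"
  proof
    fix x
    show "(\<phi> x * \<phi> x) * laplacian (\<lambda>y. ln (norm y)) x = (n - 2) * ((\<phi> x)\<^sup>2 / (norm x)\<^sup>2)"
      by (cases "x = 0") (auto simp: \<phi>0 K0 laplacian_ln_norm n_def power2_eq_square)
  qed
  also have "(\<lambda>x. grad (\<lambda>x. \<phi> x * \<phi> x) x \<bullet> grad (\<lambda>y. ln (norm y)) x) = (\<lambda>x. 2 * X x)"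
  proof
    fix x
    have "grad (\<lambda>x. \<phi> x * \<phi> x) x = (2 * \<phi> x) *\<^sub>R grad \<phi> x"
      using smooth_on_differentiable[OF sm, of x] by (simp add: grad_mult scaleR_2[symmetric])
    then show "grad (\<lambda>x. \<phi> x * \<phi> x) x \<bullet> grad (\<lambda>y. ln (norm y)) x = 2 * X x"
      by (cases "x = 0") (auto simp: \<phi>0 K0 X_def grad_ln_norm sgn_div_norm inner_commute divide_simps power2_eq_square)
  qed
  finally have green: "(n - 2) * (LINT x|lborel. (\<phi> x)\<^sup>2 / (norm x)\<^sup>2) = - (2 * (LINT x|lborel. X x))"
    by (simp only: integral_mult_right_zero)
  \<comment> \<open>The coefficient (n-2)/2 is optimal: by the identity \<open>green\<close> the
    mixed term contributes -(n-2)^2/2 and the last square +(n-2)^2/4 times the Hardy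
    integral.\<close>
  have "0 \<le> (LINT x|lborel. (sgn x \<bullet> grad \<phi> x + (n - 2) / 2 * (\<phi> x / norm x))\<^sup>2)"
    by simp
  also have "(\<lambda>x. (sgn x \<bullet> grad \<phi> x + (n - 2) / 2 * (\<phi> x / norm x))\<^sup>2) =
      (\<lambda>x. (sgn x \<bullet> grad \<phi> x)\<^sup>2 + (n - 2) * X x + (n - 2)\<^sup>2 / 4 * ((\<phi> x)\<^sup>2 / (norm x)\<^sup>2))"
    by (simp add: fun_eq_iff X_def power2_sum power_mult_distrib power_divide)
  also have "(LINT x|lborel. (sgn x \<bullet> grad \<phi> x)\<^sup>2 + (n - 2) * X x + (n - 2)\<^sup>2 / 4 * ((\<phi> x)\<^sup>2 / (norm x)\<^sup>2)) =
      (LINT x|lborel. (sgn x \<bullet> grad \<phi> x)\<^sup>2) + (n - 2) * (LINT x|lborel. X x) +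
      (n - 2)\<^sup>2 / 4 * (LINT x|lborel. (\<phi> x)\<^sup>2 / (norm x)\<^sup>2)"
    using int by (simp del: times_divide_eq_left times_divide_eq_right times_divide_times_eq)
  also have "(LINT x|lborel. X x) = - ((n - 2) / 2) * (LINT x|lborel. (\<phi> x)\<^sup>2 / (norm x)\<^sup>2)"
    using green by simp
  finally show ?thesis
    by (simp add: n_def[symmetric] power2_eq_square algebra_simps)
qed

section \<open>Quadratic forms and the generalized principal eigenvalue\<close>

lemma integral_test_fun_laplacian:
  fixes \<phi> :: "'a::euclidean_space \<Rightarrow> real"
  assumes \<phi>: "\<phi> \<in> test_fun D" and W: "continuous_on D W"
  shows "(LINT x:D|lborel. \<phi> x * (- laplacian \<phi> x - l * W x * \<phi> x)) =
      (LINT x|lborel. (norm (grad \<phi> x))\<^sup>2) - l * (LINT x|lborel. W x * (\<phi> x)\<^sup>2)"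
    and "integrable lborel (\<lambda>x. (norm (grad \<phi> x))\<^sup>2)" "integrable lborel (\<lambda>x. W x * (\<phi> x)\<^sup>2)"
proof -
  define K where "K = closure {x. \<phi> x \<noteq> 0}"
  have sm: "smooth_on UNIV \<phi>" and K: "compact K" "K \<subseteq> D"
    using \<phi> by (auto simp: test_fun_def K_def)
  have \<phi>0: "\<phi> x = 0" if "x \<notin> K" for x
    using zero_outside_support(1)[of x \<phi>] that by (simp add: K_def)
  have d\<phi>0: "grad \<phi> x = 0" if "x \<notin> K" for x
    using zero_outside_support(2)[of x \<phi>] that by (simp add: K_def)
  note cs = continuous_on_subset[OF continuous_on_grad[OF sm], of K] continuous_on_subset[OF smooth_on_continuous_on[OF sm], of K]
    continuous_on_subset[OF smooth_on_continuous_on[OF smooth_on_laplacian[OF open_UNIV sm]], of K] continuous_on_subset[OF W K(2)]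
  have int: "integrable lborel (\<lambda>x. \<phi> x * laplacian \<phi> x)"
    by (intro integrable_compact_support[OF K(1)] continuous_intros cs) (auto simp: \<phi>0)
  show i1: "integrable lborel (\<lambda>x. (norm (grad \<phi> x))\<^sup>2)"
    by (intro integrable_compact_support[OF K(1)] continuous_intros cs) (auto simp: d\<phi>0)
  show i2: "integrable lborel (\<lambda>x. W x * (\<phi> x)\<^sup>2)"
    by (intro integrable_compact_support[OF K(1)] continuous_intros cs) (auto simp: \<phi>0)
  have "(LINT x:D|lborel. \<phi> x * (- laplacian \<phi> x - l * W x * \<phi> x)) =
      (LINT x|lborel. \<phi> x * (- laplacian \<phi> x - l * W x * \<phi> x))"
    by (rule set_integral_test_fun[OF \<phi>]) simp
  also have "\<dots> = (LINT x|lborel. - (\<phi> x * laplacian \<phi> x) - l * (W x * (\<phi> x)\<^sup>2))"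
    by (rule Bochner_Integration.integral_cong) (auto simp: algebra_simps power2_eq_square)
  also have "(LINT x|lborel. - (\<phi> x * laplacian \<phi> x) - l * (W x * (\<phi> x)\<^sup>2)) =
      - (LINT x|lborel. \<phi> x * laplacian \<phi> x) - l * (LINT x|lborel. W x * (\<phi> x)\<^sup>2)"
    using int i2 by simp
  also have "- (LINT x|lborel. \<phi> x * laplacian \<phi> x) = (LINT x|lborel. (norm (grad \<phi> x))\<^sup>2)"
    using green_formula[OF open_UNIV K(1) _ sm _ sm] \<phi>0 by (simp add: power2_norm_eq_inner)
  finally show "(LINT x:D|lborel. \<phi> x * (- laplacian \<phi> x - l * W x * \<phi> x)) =
      (LINT x|lborel. (norm (grad \<phi> x))\<^sup>2) - l * (LINT x|lborel. W x * (\<phi> x)\<^sup>2)" .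
qed

text \<open>The form at \<open>\<mu>\<close> is reached although the supremum may not be attained,
  or may be infinite. If it were negative at \<phi>, the Rayleigh quotient of \<phi> would lie below
  \<open>\<mu>\<close>, hence below some admissible \<open>l\<close>, contradicting nonnegativity at
  \<open>l\<close>.\<close>

lemma le_lambda0_imp_form_nonneg:
  fixes \<phi> :: "'a::euclidean_space \<Rightarrow> real"
  assumes \<phi>: "\<phi> \<in> test_fun D" and W: "continuous_on D W" "\<And>x. 0 \<le> W x"
    and \<mu>: "ereal \<mu> \<le> lambda0 (\<lambda>u x. - laplacian u x) W D"
  shows "0 \<le> (LINT x|lborel. (norm (grad \<phi> x))\<^sup>2) - \<mu> * (LINT x|lborel. W x * (\<phi> x)\<^sup>2)" (is "0 \<le> ?A - \<mu> * ?B")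
proof (rule ccontr)
  assume neg: "\<not> 0 \<le> ?A - \<mu> * ?B"
  have nn: "0 \<le> ?A" "0 \<le> ?B"
    using W(2) by auto
  then have B: "0 < ?B"
    using neg by (cases "?B = 0") auto
  then have "ereal (?A / ?B) < ereal \<mu>"
    using neg by (simp add: divide_less_eq)
  also note \<mu>
  finally obtain l where l: "op_nonneg lborel (test_fun D) (\<lambda>u x. - laplacian u x - l * W x * u x) D" "?A / ?B < l"
    by (auto simp: lambda0_def less_Sup_iff)
  then have "0 \<le> ?A - l * ?B"
    using \<phi> integral_test_fun_laplacian(1)[OF \<phi> W(1), of l] by (auto simp: op_nonneg_def)
  then show False
    using l(2) B by (simp add: divide_less_eq)
qed

section \<open>The lower bound for \<open>sigma\<close> and the Hardy inequality on the cone\<close>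

theorem proposition5p1:
  fixes S \<Omega> :: "'a::euclidean_space set" and \<mu> :: real
  assumes "DIM('a) \<ge> 2"
    and "lipschitz_domain_sphere S"
    and "\<Omega> = cone_over S"
    and "ereal \<mu> \<le> mu0 \<Omega>"
  shows "0 \<le> hardy_lambda S \<mu> \<and>
    (\<forall>\<phi> \<in> test_fun \<Omega>.
       ereal ((LINT x:\<Omega>|lborel. (norm (grad \<phi> x))\<^sup>2)
              - \<mu> * (LINT x:\<Omega>|lborel. \<bar>\<phi> x\<bar>\<^sup>2 / (bdist \<Omega> x)\<^sup>2))
       \<ge> hardy_lambda S \<mu> * ereal (LINT x:\<Omega>|lborel. \<bar>\<phi> x\<bar>\<^sup>2 / (norm x)\<^sup>2))"
proof -
  let ?\<sigma> = "sigma S \<mu>"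
  define c where "c = (2 - real DIM('a))\<^sup>2 / 4"
  have S: "openin (top_of_set (sphere 0 1)) S" and Sne: "S \<noteq> {}"
    using assms(2) by (auto simp: lipschitz_domain_sphere_def)
  define W where "W x = 1 / (bdist \<Omega> x)\<^sup>2" for x
  have fr: "frontier \<Omega> \<noteq> {}"
    unfolding assms(3) using openin_imp_subset[OF S] Sne by (rule frontier_cone_over_nonempty)
  have W_cont: "continuous_on \<Omega> W"
    unfolding W_def[abs_def] using open_cone_over[OF S] fr assms(3) by (intro continuous_on_inverse_bdist) auto
  have W_scaleR: "W (s *\<^sub>R x) = W x / s\<^sup>2" if "0 < s" for s x
    using that fr by (simp add: W_def assms(3) bdist_cone_over_scaleR power_mult_distrib)
  have W_nonneg: "0 \<le> W x" for x by (simp add: W_def)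
  have zero: "0 \<notin> \<Omega>" by (simp add: assms(3) zero_notin_cone_over)
  have form: "0 \<le> (LINT x|lborel. (norm (grad \<phi> x))\<^sup>2) - \<mu> * (LINT x|lborel. W x * (\<phi> x)\<^sup>2)"
    if "\<phi> \<in> test_fun \<Omega>" for \<phi>
    using le_lambda0_imp_form_nonneg[OF that W_cont W_nonneg] assms(4) by (simp add: mu0_def W_def[abs_def])
  \<comment> \<open>The admissible set is written with the weight 1 left in place, so that it
    matches the unfolded \<open>sigma\<close>.\<close>
  define L where "L = {l. op_nonneg surface_measure (test_fun_sphere S)
      (\<lambda>u x. (- laplace_beltrami u x - \<mu> * (1 / (bdist (cone_over S) x)\<^sup>2) * u x) - l * 1 * u x) S}"
  have sigma: "?\<sigma> = Sup (ereal ` L)"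
    by (simp add: sigma_def lambda0_sphere_def L_def image_Collect)
  \<comment> \<open>The spectral parameter is absorbed into the potential as l/|x|^2, which has
    degree -2 and equals l on the sphere. One potential then serves on the sphere and on the
    cone.\<close>
  have L_iff: "l \<in> L \<longleftrightarrow> (\<forall>\<psi>\<in>test_fun_sphere S. 0 \<le> (LINT w:sphere 0 1|surface_measure.
      (norm (grad (sphere_ext \<psi>) w))\<^sup>2 - (\<mu> * W w + l * (1 / (norm w)\<^sup>2)) * (\<psi> w)\<^sup>2))" for l
  proof -
    let ?V = "\<lambda>w. \<mu> * W w + l * (1 / (norm w)\<^sup>2)"
    have V: "continuous_on (cone_over S) ?V" "\<And>s x. 0 < s \<Longrightarrow> ?V (s *\<^sub>R x) = ?V x / s\<^sup>2"
      using W_cont zero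
      by (auto simp: assms(3) W_scaleR power_mult_distrib add_divide_distrib intro!: continuous_intros)
    have "(LINT w:S|surface_measure. \<psi> w * ((- laplace_beltrami \<psi> w - \<mu> * (1 / (bdist (cone_over S) w)\<^sup>2) * \<psi> w) - l * 1 * \<psi> w))
        = (LINT w:sphere 0 1|surface_measure. (norm (grad (sphere_ext \<psi>) w))\<^sup>2 - ?V w * (\<psi> w)\<^sup>2)"
      if \<psi>: "\<psi> \<in> test_fun_sphere S" for \<psi>
    proof -
      have "indicat_real S w *\<^sub>R (\<psi> w * ((- laplace_beltrami \<psi> w - \<mu> * (1 / (bdist (cone_over S) w)\<^sup>2) * \<psi> w) - l * 1 * \<psi> w)) =
        indicat_real S w *\<^sub>R (\<psi> w * (- laplace_beltrami \<psi> w - ?V w * \<psi> w))" for w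
        using openin_imp_subset[OF S]
        by (cases "w \<in> S") (auto simp: W_def assms(3) algebra_simps)
      then have "(LINT w:S|surface_measure. \<psi> w * ((- laplace_beltrami \<psi> w - \<mu> * (1 / (bdist (cone_over S) w)\<^sup>2) * \<psi> w) - l * 1 * \<psi> w))
          = (LINT w:S|surface_measure. \<psi> w * (- laplace_beltrami \<psi> w - ?V w * \<psi> w))"
        unfolding set_lebesgue_integral_def by (intro Bochner_Integration.integral_cong refl)
      also have "\<dots> = (LINT w:sphere 0 1|surface_measure. (norm (grad (sphere_ext \<psi>) w))\<^sup>2 - ?V w * (\<psi> w)\<^sup>2)"
        by (rule sphere_form_eq[OF S V \<psi>])
      finally show ?thesis .
    qed
    then show ?thesis by (auto simp: L_def op_nonneg_def)
  qed
  \<comment> \<open>This gives \<sigma>(\<mu>) \<ge> -(n-2)^2/4, that is, \<lambda>(\<mu>) \<ge> 0.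
    It also rules out that the supremum is minus infinity.\<close>
  have "- c \<in> L"
    unfolding L_iff
  proof
    fix \<psi> assume \<psi>: "\<psi> \<in> test_fun_sphere S"
    have "0 \<le> (LINT w:sphere 0 1|surface_measure. (norm (grad (sphere_ext \<psi>) w))\<^sup>2 - (\<mu> * W w - c) * (\<psi> w)\<^sup>2)"
      unfolding c_def
    proof (rule sphere_form_nonneg[OF S _ _ \<psi>])
      show "continuous_on (cone_over S) (\<lambda>w. \<mu> * W w)"
        using W_cont by (auto simp: assms(3) intro!: continuous_intros)
      show "\<mu> * W (s *\<^sub>R x) = \<mu> * W x / s\<^sup>2" if "0 < s" for s x
        using that by (simp add: W_scaleR)
      show "0 \<le> (LINT x|lborel. (norm (grad \<phi> x))\<^sup>2 - \<mu> * W x * (\<phi> x)\<^sup>2)" if "\<phi> \<in> test_fun (cone_over S)" for \<phi>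
        using form[of \<phi>] that integral_test_fun_laplacian(2,3)[OF that, of W] W_cont
        by (simp add: assms(3) mult.assoc)
    qed
    also have "\<dots> = (LINT w:sphere 0 1|surface_measure.
        (norm (grad (sphere_ext \<psi>) w))\<^sup>2 - (\<mu> * W w + - c * (1 / (norm w)\<^sup>2)) * (\<psi> w)\<^sup>2)"
      by (rule set_lebesgue_integral_cong) auto
    finally show "0 \<le> \<dots>" .
  qed
  then have sigma_ge: "ereal (- c) \<le> ?\<sigma>"
    unfolding sigma by (intro Sup_upper) auto
  have hardy: "hardy_lambda S \<mu> = (ereal (4 * c) + 4 * ?\<sigma>) / 4"
    by (simp add: hardy_lambda_def c_def)
  have nonneg: "0 \<le> hardy_lambda S \<mu>"
    unfolding hardy using sigma_ge by (cases ?\<sigma>) auto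
  moreover have "hardy_lambda S \<mu> * ereal (LINT x:\<Omega>|lborel. \<bar>\<phi> x\<bar>\<^sup>2 / (norm x)\<^sup>2) \<le>
      ereal ((LINT x:\<Omega>|lborel. (norm (grad \<phi> x))\<^sup>2) - \<mu> * (LINT x:\<Omega>|lborel. \<bar>\<phi> x\<bar>\<^sup>2 / (bdist \<Omega> x)\<^sup>2))"
    if \<phi>: "\<phi> \<in> test_fun \<Omega>" for \<phi>
  proof -
    define A where "A = (LINT x|lborel. (norm (grad \<phi> x))\<^sup>2)"
    define B where "B = (LINT x|lborel. W x * (\<phi> x)\<^sup>2)"
    define I where "I = (LINT x|lborel. (\<phi> x)\<^sup>2 / (norm x)\<^sup>2)"
    have \<phi>0: "\<phi> \<in> test_fun (- {0})"
      using \<phi> zero by (auto simp: test_fun_def)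
    have "grad \<phi> x = 0" if "x \<notin> \<Omega>" for x
    proof -
      have "x \<notin> closure {x. \<phi> x \<noteq> 0}"
        using \<phi> that by (auto simp: test_fun_def)
      then show ?thesis
        by (rule zero_outside_support)
    qed
    then have eqA: "(LINT x:\<Omega>|lborel. (norm (grad \<phi> x))\<^sup>2) = A"
      unfolding A_def set_lebesgue_integral_def
      by (intro Bochner_Integration.integral_cong) (auto split: split_indicator)
    have eqB: "(LINT x:\<Omega>|lborel. \<bar>\<phi> x\<bar>\<^sup>2 / (bdist \<Omega> x)\<^sup>2) = B"
      using set_integral_test_fun[OF \<phi>, of "\<lambda>x. \<bar>\<phi> x\<bar>\<^sup>2 / (bdist \<Omega> x)\<^sup>2"] by (simp add: B_def W_def)
    have eqI: "(LINT x:\<Omega>|lborel. \<bar>\<phi> x\<bar>\<^sup>2 / (norm x)\<^sup>2) = I"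
      using set_integral_test_fun[OF \<phi>, of "\<lambda>x. \<bar>\<phi> x\<bar>\<^sup>2 / (norm x)\<^sup>2"] by (simp add: I_def)
    have AB: "0 \<le> A - \<mu> * B"
      using form[OF \<phi>] by (simp add: A_def B_def)
    have I: "0 \<le> I" by (simp add: I_def)
    \<comment> \<open>\<open>cone_form_nonneg\<close> bounds the tangential energy below by \<mu> B
      + l I, and \<open>radial_hardy\<close> bounds the radial energy below by c I. The two energies
      add up to \<open>A\<close>.\<close>
    have ineq: "(c + l) * I \<le> A - \<mu> * B" if "l \<in> L" for l
    proof -
      let ?V = "\<lambda>w. \<mu> * W w + l * (1 / (norm w)\<^sup>2)"
      have V: "continuous_on (cone_over S) ?V" "\<And>s x. 0 < s \<Longrightarrow> ?V (s *\<^sub>R x) = ?V x / s\<^sup>2"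
        using W_cont zero
        by (auto simp: assms(3) W_scaleR power_mult_distrib add_divide_distrib intro!: continuous_intros)
      have n: "continuous_on (- {0::'a}) (\<lambda>x. 1 / (norm x)\<^sup>2)"
        by (intro continuous_intros) auto
      have int: "integrable lborel (\<lambda>x. (norm (grad \<phi> x))\<^sup>2)" "integrable lborel (\<lambda>x. W x * (\<phi> x)\<^sup>2)"
          "integrable lborel (\<lambda>x. (\<phi> x)\<^sup>2 / (norm x)\<^sup>2)"
        using integral_test_fun_laplacian(2,3)[OF \<phi> W_cont] integral_test_fun_laplacian(3)[OF \<phi>0 n] by auto
      have int_r: "integrable lborel (\<lambda>x. (sgn x \<bullet> grad \<phi> x)\<^sup>2)"
        by (rule integrable_radial_grad(1)[OF \<phi>0])
      have "0 \<le> (LINT x|lborel. (norm (grad \<phi> x))\<^sup>2 - (sgn x \<bullet> grad \<phi> x)\<^sup>2 - ?V x * (\<phi> x)\<^sup>2)"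
        using \<phi> \<open>l \<in> L\<close> unfolding L_iff assms(3) by (intro cone_form_nonneg[OF S V]) auto
      also have "(\<lambda>x. (norm (grad \<phi> x))\<^sup>2 - (sgn x \<bullet> grad \<phi> x)\<^sup>2 - ?V x * (\<phi> x)\<^sup>2) =
          (\<lambda>x. (norm (grad \<phi> x))\<^sup>2 - (sgn x \<bullet> grad \<phi> x)\<^sup>2 - (\<mu> * (W x * (\<phi> x)\<^sup>2) + l * ((\<phi> x)\<^sup>2 / (norm x)\<^sup>2)))"
        by (simp add: fun_eq_iff algebra_simps)
      finally have "0 \<le> A - (LINT x|lborel. (sgn x \<bullet> grad \<phi> x)\<^sup>2) - (\<mu> * B + l * I)"
        using int int_r
        by (simp add: A_def B_def I_def del: times_divide_eq_left times_divide_eq_right)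
      then show ?thesis
        using radial_hardy[OF \<phi>0] by (simp add: c_def I_def algebra_simps)
    qed
    have "hardy_lambda S \<mu> * ereal I \<le> ereal (A - \<mu> * B)"
    \<comment> \<open>If I = 0, the product is 0 in the extended reals even if
      \<open>hardy_lambda\<close> were infinite, and what remains is nonnegativity of the form at
      \<mu>.\<close>
    proof (cases "I = 0")
      case True
      then show ?thesis using AB by (simp flip: zero_ereal_def)
    next
      case False
      then have I0: "0 < I" using I by simp
      \<comment> \<open>Dividing \<open>ineq\<close> by I > 0 bounds every admissible
        \<open>l\<close>. So the supremum is a real number, and its bound is the desired
        inequality.\<close>
      have "?\<sigma> \<le> ereal ((A - \<mu> * B) / I - c)"
        unfolding sigma
      proof (rule Sup_least)
        fix y assume "y \<in> ereal ` L"
        then show "y \<le> ereal ((A - \<mu> * B) / I - c)"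
          using ineq I0 by (auto simp: field_simps)
      qed
      then obtain s where s: "?\<sigma> = ereal s" "s \<le> (A - \<mu> * B) / I - c"
        using sigma_ge by (cases ?\<sigma>) auto
      then show ?thesis
        unfolding hardy using I0 by (simp add: field_simps)
    qed
    then show ?thesis by (simp only: eqA eqB eqI)
  qed
  ultimately show ?thesis by blast
qed

end
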